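(* Let $n\in\mathbb{N}$, $0<s<1$, $1<p<\infty$ satisfy $n/p<1+s$, and let $q=\frac{n(n+1)}{n+2}+\frac{p(n+1+s)}{n+2}$. For every measurable $f:\mathbb{R}^n\to\mathbb{R}$ we have $\mathcal{E}_{p,q}(f)<\infty$ if and only if $[f]_{W^{1+s,p}(\mathbb{R}^n)}<\infty$. Furthermore, there exists a constant $C=C(n,p,s)$ such that \[ C^{-1}[f]^p_{W^{1+s,p}(\mathbb{R}^n)}\le\mathcal{E}_{p,q}(f)\le C[f]^p_{W^{1+s,p}(\mathbb{R}^n)}. \]
   Context: For $f:\mathbb{R}^n\to\mathbb{R}$ measurable write $F(x)=(x,f(x))\in\mathbb{R}^{n+1}$. For $x_0,\dots,x_{n+1}\in\mathbb{R}^n$ let $\Delta(F(x_0),\dots,F(x_{n+1}))$ be the convex hull of the points $F(x_i)$, $\mathcal{H}^{n+1}$ the $(n+1)$-dimensional Hausdorff (=Lebesgue) measure, and $\mathrm{diam}(x_0,\dots,x_{n+1})=\max_{i,j}|x_i-x_j|$. Define \[ \mathcal{E}_{p,q}(f)=\int_{(\mathbb{R}^n)^{n+2}}\frac{\mathcal{H}^{n+1}(\Delta(F(x_0),\dots,F(x_{n+1})))^p}{\mathrm{diam}(x_0,\dots,x_{n+1})^{(n+2)q}}\,dx_0\cdots dx_{n+1}, \] and \[ [f]_{W^{1+s,p}(\mathbb{R}^n)}=\Big(\int_{\mathbb{R}^n}\int_{\mathbb{R}^n}\frac{|f(x+h)-2f(x)+f(x-h)|^p}{|h|^{n+(1+s)p}}\,dh\,dx\Big)^{1/p}.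 \] *)

theory Defs
  imports "HOL-Analysis.Analysis"
begin

definition graph_pt :: "('a::euclidean_space \<Rightarrow> real) \<Rightarrow> 'a \<Rightarrow> 'a \<times> real" where
  "graph_pt f x = (x, f x)"

definition diam_pts :: "nat \<Rightarrow> (nat \<Rightarrow> 'a::euclidean_space) \<Rightarrow> real" where
  "diam_pts m x = Max {dist (x i) (x j) | i j. i \<le> m \<and> j \<le> m}"

text \<open>The energy E_{p,q}(f), n = DIM('a); the n+2 points are indexed by {0..n+1}.
  The (n+1)-dimensional Hausdorff measure on R^(n+1) is Lebesgue measure.\<close>
definition energy :: "real \<Rightarrow> real \<Rightarrow> ('a::euclidean_space \<Rightarrow> real) \<Rightarrow> ennreal" where
  "energy p q f =
     (\<integral>\<^sup>+ x. ennreal (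
        measure lebesgue (convex hull {graph_pt f (x i) | i. i \<le> DIM('a) + 1}) powr p
        / diam_pts (DIM('a) + 1) x powr (real (DIM('a) + 2) * q))
      \<partial>(PiM {..DIM('a) + 1} (\<lambda>_. (lebesgue :: 'a measure))))"

definition sobolev_seminorm_pow :: "real \<Rightarrow> real \<Rightarrow> ('a::euclidean_space \<Rightarrow> real) \<Rightarrow> ennreal" where
  "sobolev_seminorm_pow s p f =
     (\<integral>\<^sup>+ x. (\<integral>\<^sup>+ h. ennreal (\<bar>f (x + h) - 2 * f x + f (x - h)\<bar> powr p
        / norm h powr (real DIM('a) + (1 + s) * p)) \<partial>lebesgue) \<partial>lebesgue)"

end

theory Submission
  imports Defs
begin

text \<open>
  Lower bound. Fix \<open>x\<close>, \<open>h\<close> and points \<open>z\<^sub>b\<close> near \<open>x + \<bar>h\<bar> b\<close> for the basis vectors \<open>b\<close>, and let \<open>\<ell>\<close> be the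
  affine function that agrees with \<open>f\<close> at \<open>x\<close> and all \<open>z\<^sub>b\<close>. The simplex over \<open>x\<close>, \<open>z\<^sub>b\<close> and \<open>y\<close> has
  volume comparable to \<open>\<bar>h\<bar>\<^sup>n \<bar>f y - \<ell> y\<bar>\<close>, and the values of \<open>f - \<ell>\<close> at \<open>x + h\<close> and \<open>x - h\<close> add up to
  the second difference of \<open>f\<close> at \<open>x\<close>. Integrating over \<open>z\<close> gives the bound.

  Upper bound. If the points lie in a ball of radius \<open>r\<close>, the volume is at most a constant times \<open>r\<^sup>n\<close> times
  the largest value of \<open>\<bar>f - \<ell>\<bar>\<close> at the points, for any affine \<open>\<ell>\<close>. Take for \<open>\<ell>\<close> the first Taylor
  polynomial at \<open>x\<^sub>0\<close> of the convolution of \<open>f\<close> with the even kernel \<open>(max 0 (1 - \<bar>w\<bar>\<^sup>2/\<rho>\<^sup>2))\<^sup>2\<close>, where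
  \<open>\<rho> = r/2\<close>. Evenness of the kernel and oddness of its gradient turn the mollification error and the increments
  of the gradient into averages of second differences. Writing \<open>diam\<^sup>-\<^sup>\<beta>\<close> as an integral over \<open>r > diam\<close>
  decouples \<open>r\<close> from the points, and Fubini and translation invariance finish the proof.
\<close>

subsection \<open>Translations, reflections and shears of Lebesgue measure\<close>

lemma lborel_distr_reflect_euclidean:
  "distr lborel borel (\<lambda>w. a - w) = (lborel :: 'a::euclidean_space measure)"
  using lborel_affine[of "-1" a] by (simp add: density_1)

lemma nn_integral_lborel_translate:
  fixes g :: "'a::euclidean_space \<Rightarrow> ennreal"
  assumes "g \<in> borel_measurable borel"
  shows "(\<integral>\<^sup>+w. g (a + w) \<partial>lborel) = (\<integral>\<^sup>+w. g w \<partial>lborel)"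
  using nn_integral_distr[of "(+) a" lborel borel g] assms by (simp add: lborel_distr_plus)

lemma nn_integral_lborel_reflect:
  fixes g :: "'a::euclidean_space \<Rightarrow> ennreal"
  assumes "g \<in> borel_measurable borel"
  shows "(\<integral>\<^sup>+w. g (a - w) \<partial>lborel) = (\<integral>\<^sup>+w. g w \<partial>lborel)"
  using nn_integral_distr[of "\<lambda>w. a - w" lborel borel g] assms
  by (simp add: lborel_distr_reflect_euclidean)

lemma integral_lborel_translate:
  fixes g :: "'a::euclidean_space \<Rightarrow> 'b::{banach, second_countable_topology}"
  assumes "g \<in> borel_measurable borel"
  shows "(\<integral>w. g (a + w) \<partial>lborel) = (\<integral>w. g w \<partial>lborel)"
  using integral_distr[of "(+) a" lborel borel g] assms by (simp add: lborel_distr_plus)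

lemma integral_lborel_uminus:
  fixes g :: "'a::euclidean_space \<Rightarrow> 'b::{banach, second_countable_topology}"
  assumes "g \<in> borel_measurable borel"
  shows "(\<integral>w. g (- w) \<partial>lborel) = (\<integral>w. g w \<partial>lborel)"
  using integral_distr[of "\<lambda>w. 0 - w" lborel borel g] assms
  unfolding lborel_distr_reflect_euclidean by simp

lemma integrable_lborel_reflect_iff:
  fixes g :: "'a::euclidean_space \<Rightarrow> 'b::{banach, second_countable_topology}"
  assumes "g \<in> borel_measurable borel"
  shows "integrable lborel (\<lambda>w. g (a - w)) \<longleftrightarrow> integrable lborel g"
  using integrable_distr_eq[of "\<lambda>w. a - w" lborel borel g] assms
  by (simp add: lborel_distr_reflect_euclidean)

lemma AE_lborel_translate:
  fixes P :: "'a::euclidean_space \<Rightarrow> bool"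
  assumes "AE x in lborel. P x"
  shows "AE h in lborel. P (a + h)"
  by (rule AE_distrD[of "(+) a" lborel borel]) (use assms in \<open>simp, unfold lborel_distr_plus\<close>)

lemma AE_lborel_reflect:
  fixes P :: "'a::euclidean_space \<Rightarrow> bool"
  assumes "AE x in lborel. P x"
  shows "AE h in lborel. P (a - h)"
  by (rule AE_distrD[of "\<lambda>h. a - h" lborel borel])
    (use assms in \<open>simp, unfold lborel_distr_reflect_euclidean\<close>)

lemma measurable_shear:
  fixes g :: "'a::euclidean_space \<Rightarrow> 'b::euclidean_space"
  assumes [measurable]: "g \<in> borel_measurable borel"
  shows "(\<lambda>z. (fst z, g (fst z) + snd z)) \<in> borel_measurable borel"
  unfolding borel_prod[symmetric] by measurable

lemma lborel_distr_shear:
  fixes g :: "'a::euclidean_space \<Rightarrow> 'b::euclidean_space"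
  assumes [measurable]: "g \<in> borel_measurable borel"
  shows "distr lborel borel (\<lambda>z. (fst z, g (fst z) + snd z)) = lborel"
proof (rule measure_eqI)
  let ?shear = "\<lambda>z. (fst z, g (fst z) + snd z)"
  fix A assume "A \<in> sets (distr lborel borel ?shear)"
  hence A: "A \<in> sets borel" by simp
  hence [measurable]: "A \<in> sets (lborel \<Otimes>\<^sub>M lborel)"
    by (subst lborel_prod) simp
  have "emeasure (distr lborel borel ?shear) A = (\<integral>\<^sup>+z. indicator A (?shear z) \<partial>lborel)"
    using A measurable_shear[of g]
    by (subst nn_integral_indicator[symmetric], simp, subst nn_integral_distr) auto
  also have "\<dots> = (\<integral>\<^sup>+x. (\<integral>\<^sup>+y. indicator A (x, g x + y) \<partial>lborel) \<partial>lborel)"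
    unfolding lborel_prod[symmetric] by (subst lborel.nn_integral_fst[symmetric]) simp_all
  also have "\<dots> = (\<integral>\<^sup>+x. (\<integral>\<^sup>+y. indicator A (x, y) \<partial>lborel) \<partial>lborel)"
    by (intro nn_integral_cong nn_integral_lborel_translate) measurable
  also have "\<dots> = emeasure lborel A"
    using lborel.nn_integral_fst[of "indicator A" lborel] A by (simp add: lborel_prod)
  finally show "emeasure (distr lborel borel ?shear) A = emeasure lborel A" .
qed simp

subsection \<open>Volumes of convex hulls of graph points\<close>

definition graph_hull_volume :: "('a::euclidean_space \<Rightarrow> real) \<Rightarrow> 'a set \<Rightarrow> real" where
  "graph_hull_volume f A = measure lebesgue (convex hull (graph_pt f ` A))"

lemma graph_hull_volume_nonneg [simp]: "0 \<le> graph_hull_volume f A"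
  by (simp add: graph_hull_volume_def)

lemma sets_borel_convex_hull_finite:
  fixes A :: "'a::euclidean_space set"
  assumes "finite A"
  shows "convex hull A \<in> sets borel"
  using finite_imp_compact_convex_hull[OF assms] by (rule borel_compact)

lemma emeasure_convex_hull_finite:
  fixes A :: "'a::euclidean_space set"
  assumes "finite A"
  shows "emeasure lborel (convex hull A) = ennreal (measure lebesgue (convex hull A))"
proof -
  have "emeasure lborel (convex hull A) < \<infinity>"
    by (rule emeasure_compact_finite[OF finite_imp_compact_convex_hull[OF assms]])
  thus ?thesis
    using sets_borel_convex_hull_finite[OF assms] by (simp add: emeasure_eq_ennreal_measure)
qed

lemma emeasure_graph_hull:
  assumes "finite A"
  shows "emeasure lborel (convex hull (graph_pt f ` A)) = ennreal (graph_hull_volume f A)"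
  unfolding graph_hull_volume_def using assms by (simp add: emeasure_convex_hull_finite)

lemma graph_hull_volume_add_affine:
  assumes "finite A"
  shows "graph_hull_volume (\<lambda>x. f x + (a + c \<bullet> x)) A = graph_hull_volume f A"
proof -
  let ?shear = "\<lambda>z. (fst z, (a + c \<bullet> fst z) + snd z)"
  let ?lin = "\<lambda>z::'a \<times> real. (fst z, c \<bullet> fst z + snd z)"
  let ?S = "convex hull (graph_pt f ` A)" and ?T = "convex hull (graph_pt (\<lambda>x. f x + (a + c \<bullet> x)) ` A)"
  have "linear ?lin"
    by (rule linearI) (auto simp: inner_add_right algebra_simps)
  moreover have "?shear = (+) (0, a) \<circ> ?lin"
    by auto
  ultimately have "?shear ` ?S = convex hull (?shear ` (graph_pt f ` A))"
    by (simp only: image_comp[symmetric] convex_hull_linear_image convex_hull_translation)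
  also have "?shear ` (graph_pt f ` A) = graph_pt (\<lambda>x. f x + (a + c \<bullet> x)) ` A"
    unfolding image_image by (simp add: graph_pt_def add_ac)
  finally have "?shear -` ?T = ?shear -` (?shear ` ?S)" by simp
  also have "\<dots> = ?S"
    by (rule inj_vimage_image_eq) (auto simp: inj_def)
  finally have preimage: "?shear -` ?T = ?S" .
  have "?T \<in> sets borel"
    using assms by (simp add: sets_borel_convex_hull_finite)
  hence "emeasure (distr lborel borel ?shear) ?T = emeasure lborel ?S"
    by (subst emeasure_distr) (auto simp: preimage intro!: measurable_shear)
  hence "emeasure lborel ?T = emeasure lborel ?S"
    using lborel_distr_shear[of "\<lambda>x. a + c \<bullet> x"] by simp
  thus ?thesis using assms by (simp add: emeasure_graph_hull)
qed

lemma graph_hull_volume_diff_affine: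
  assumes "finite A"
  shows "graph_hull_volume (\<lambda>x. f x - (a + c \<bullet> x)) A = graph_hull_volume f A"
  using graph_hull_volume_add_affine[OF assms, of f "- a" "- c"] by (simp add: algebra_simps)

lemma graph_hull_volume_le:
  fixes f :: "'a::euclidean_space \<Rightarrow> real"
  assumes "finite A" "A \<subseteq> cball x0 r" "0 \<le> r" "0 \<le> M" and f: "\<And>y. y \<in> A \<Longrightarrow> \<bar>f y\<bar> \<le> M"
  shows "graph_hull_volume f A \<le> 2 * M * (unit_ball_vol DIM('a) * r ^ DIM('a))"
proof -
  let ?box = "cball x0 r \<times> {- M..M}"
  have "convex hull (graph_pt f ` A) \<subseteq> ?box"
    using assms(2) f by (intro hull_minimal convex_Times) (force simp: graph_pt_def abs_le_iff)+
  hence "emeasure lborel (convex hull (graph_pt f ` A)) \<le> emeasure (lborel \<Otimes>\<^sub>M lborel) ?box"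
    unfolding lborel_prod by (intro emeasure_mono) (auto intro!: borel_closed closed_Times)
  also have "\<dots> = ennreal (unit_ball_vol DIM('a) * r ^ DIM('a)) * ennreal (2 * M)"
    using \<open>0 \<le> r\<close> \<open>0 \<le> M\<close> by (subst lborel.emeasure_pair_measure_Times) (simp_all add: emeasure_cball)
  also have "\<dots> = ennreal (2 * M * (unit_ball_vol DIM('a) * r ^ DIM('a)))"
    using \<open>0 \<le> r\<close> \<open>0 \<le> M\<close> by (simp add: ennreal_mult mult.commute)
  finally show ?thesis
    using assms by (simp add: emeasure_graph_hull)
qed

lemma emeasure_graph_cone_slice_ge:
  fixes f :: "'a::euclidean_space \<Rightarrow> real"
  assumes "finite A" and f: "\<And>x. x \<in> A \<Longrightarrow> f x = 0" and t: "0 \<le> t" "t \<le> 1"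
  shows "ennreal ((1 - t) ^ DIM('a) * measure lebesgue (convex hull A))
    \<le> emeasure lborel ((\<lambda>x. (x, t * f y)) -` (convex hull (graph_pt f ` insert y A)))"
proof -
  let ?cone = "convex hull (graph_pt f ` insert y A)"
  let ?slice = "(\<lambda>x. (x, t * f y)) -` ?cone" and ?scaled = "(\<lambda>x. (1 - t) *\<^sub>R x + t *\<^sub>R y) ` (convex hull A)"
  have "(\<lambda>x. (x, 0)) ` (convex hull A) = convex hull ((\<lambda>x. (x, 0::real)) ` A)"
    by (intro convex_hull_linear_image linearI) auto
  also have "\<dots> = convex hull (graph_pt f ` A)"
    using f by (simp add: graph_pt_def cong: image_cong)
  also have "\<dots> \<subseteq> ?cone"
    by (intro hull_mono image_mono) auto
  finally have base: "(x, 0) \<in> ?cone" if "x \<in> convex hull A" for x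
    using that by blast
  have "?cone \<in> sets (lborel \<Otimes>\<^sub>M lborel)"
    using assms by (subst lborel_prod) (simp add: sets_borel_convex_hull_finite)
  hence slice [measurable]: "?slice \<in> sets lborel"
    by (rule sets_Pair2)
  have "emeasure lebesgue (convex hull A) = ennreal (measure lebesgue (convex hull A))"
    using assms by (simp add: emeasure_convex_hull_finite sets_borel_convex_hull_finite)
  hence "ennreal ((1 - t) ^ DIM('a) * measure lebesgue (convex hull A)) = emeasure lebesgue ?scaled"
    using t by (simp add: emeasure_lebesgue_affine ennreal_mult)
  also have "\<dots> \<le> emeasure lebesgue ?slice"
  proof (rule emeasure_mono)
    show "?scaled \<subseteq> ?slice"
    proof (rule image_subsetI)
      fix x assume "x \<in> convex hull A"
      hence "(1 - t) *\<^sub>R (x, 0) + t *\<^sub>R graph_pt f y \<in> ?cone"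
        using base t by (intro convexD_alt convex_convex_hull) (simp_all add: hull_inc)
      thus "(1 - t) *\<^sub>R x + t *\<^sub>R y \<in> ?slice"
        by (simp add: graph_pt_def)
    qed
  qed (use slice in simp)
  also have "\<dots> = emeasure lborel ?slice"
    using slice by simp
  finally show ?thesis .
qed

lemma graph_hull_volume_cone_ge:
  fixes f :: "'a::euclidean_space \<Rightarrow> real"
  assumes "finite A" and f: "\<And>x. x \<in> A \<Longrightarrow> f x = 0"
  shows "measure lebesgue (convex hull A) * \<bar>f y\<bar> / 2 ^ (DIM('a) + 1) \<le> graph_hull_volume f (insert y A)"
proof -
  let ?V = "measure lebesgue (convex hull A)" and ?cone = "convex hull (graph_pt f ` insert y A)"
  let ?heights = "closed_segment 0 (f y / 2)"
  have slice: "ennreal (?V / 2 ^ DIM('a)) \<le> emeasure lborel ((\<lambda>x. (x, \<tau>)) -` ?cone)"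
    if \<tau>: "\<tau> \<in> ?heights" for \<tau>
  proof -
    obtain u where "0 \<le> u" "u \<le> 1" "\<tau> = u * (f y / 2)"
      using \<tau> by (auto simp: in_segment)
    then obtain t where t: "0 \<le> t" "t \<le> 1 / 2" "\<tau> = t * f y"
      by (intro that[of "u / 2"]) auto
    have "(1 / 2) ^ DIM('a) * ?V \<le> (1 - t) ^ DIM('a) * ?V"
      using t by (intro mult_right_mono power_mono) auto
    thus ?thesis
      using emeasure_graph_cone_slice_ge[of A f t y] assms t
      by (auto simp: power_divide intro: order_trans[OF ennreal_leI])
  qed
  have "ennreal (?V * \<bar>f y\<bar> / 2 ^ (DIM('a) + 1)) = ennreal (?V / 2 ^ DIM('a)) * ennreal (\<bar>f y\<bar> / 2)"
    by (simp add: ennreal_mult[symmetric])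
  also have "\<dots> = (\<integral>\<^sup>+\<tau>. ennreal (?V / 2 ^ DIM('a)) * indicator ?heights \<tau> \<partial>lborel)"
    by (subst nn_integral_cmult_indicator) (auto simp: closed_segment_eq_real_ivl)
  also have "\<dots> \<le> (\<integral>\<^sup>+\<tau>. emeasure lborel ((\<lambda>x. (x, \<tau>)) -` ?cone) \<partial>lborel)"
    using slice by (intro nn_integral_mono) (auto simp: indicator_def)
  also have "\<dots> = emeasure lborel ?cone"
    by (subst lborel_prod[symmetric], rule lborel_pair.emeasure_pair_measure_alt2[symmetric],
        subst lborel_prod) (use assms in \<open>simp add: sets_borel_convex_hull_finite\<close>)
  also have "\<dots> = ennreal (graph_hull_volume f (insert y A))"
    using assms by (intro emeasure_graph_hull) simp
  finally show ?thesis by simp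
qed

definition frame_map :: "('a::euclidean_space \<Rightarrow> 'a) \<Rightarrow> 'a \<Rightarrow> 'a" where
  "frame_map v a = (\<Sum>b\<in>Basis. (a \<bullet> b) *\<^sub>R v b)"

lemma linear_frame_map: "linear (frame_map v)"
  unfolding frame_map_def
  by (rule linearI) (simp_all add: inner_add_left scaleR_add_left sum.distrib scaleR_sum_right)

lemma frame_map_Basis: "b \<in> Basis \<Longrightarrow> frame_map v b = v b"
  by (simp add: frame_map_def inner_Basis if_distrib[of "\<lambda>t. t *\<^sub>R _"] cong: if_cong)

lemma frame_map_expansive:
  fixes v :: "'a::euclidean_space \<Rightarrow> 'a"
  assumes "\<And>b. b \<in> Basis \<Longrightarrow> norm (v b - r *\<^sub>R b) \<le> r / (2 * real DIM('a))"
  shows "r * norm a \<le> 2 * norm (frame_map v a)"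
proof -
  have "frame_map v a - r *\<^sub>R a = frame_map v a - r *\<^sub>R (\<Sum>b\<in>Basis. (a \<bullet> b) *\<^sub>R b)"
    by (simp add: euclidean_representation)
  also have "\<dots> = (\<Sum>b\<in>Basis. (a \<bullet> b) *\<^sub>R (v b - r *\<^sub>R b))"
    by (simp add: frame_map_def scaleR_diff_right sum_subtractf scaleR_sum_right mult.commute)
  also have "norm \<dots> \<le> (\<Sum>b\<in>(Basis::'a set). norm a * (r / (2 * real DIM('a))))"
    by (intro sum_norm_le, unfold norm_scaleR, intro mult_mono) (auto intro: assms Basis_le_norm)
  also have "\<dots> = r * norm a / 2" by simp
  finally have "norm (frame_map v a - r *\<^sub>R a) \<le> r * norm a / 2" .
  moreover have "r * norm a \<le> norm (frame_map v a) + norm (frame_map v a - r *\<^sub>R a)"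
    using norm_triangle_ineq4[of "frame_map v a" "frame_map v a - r *\<^sub>R a"]
      order_trans[OF mult_right_mono[OF abs_ge_self[of r]]] by simp
  ultimately show ?thesis by linarith
qed

lemma bij_frame_map:
  fixes v :: "'a::euclidean_space \<Rightarrow> 'a"
  assumes "0 < r" "\<And>b. b \<in> Basis \<Longrightarrow> norm (v b - r *\<^sub>R b) \<le> r / (2 * real DIM('a))"
  shows "bij (frame_map v)"
proof -
  have "a = 0" if "frame_map v a = 0" for a
    using frame_map_expansive[of v r a, OF assms(2)] that assms(1) by (simp add: mult_le_0_iff)
  hence "inj (frame_map v)"
    by (auto simp: linear_injective_0[OF linear_frame_map])
  thus ?thesis
    by (simp add: bij_def linear_injective_imp_surjective[OF linear_frame_map])
qed

lemma ex_inner_frame_eq: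
  fixes v :: "'a::euclidean_space \<Rightarrow> 'a" and g :: "'a \<Rightarrow> real"
  assumes "bij (frame_map v)"
  shows "\<exists>c. \<forall>b\<in>Basis. c \<bullet> v b = g b"
proof (intro exI ballI)
  define d where "d = (\<Sum>b\<in>Basis. g b *\<^sub>R b)"
  fix b :: 'a assume b: "b \<in> Basis"
  have "linear (inv (frame_map v))"
    using assms by (simp add: inj_linear_imp_inv_linear linear_frame_map bij_is_inj)
  hence "adjoint (inv (frame_map v)) d \<bullet> v b = d \<bullet> inv (frame_map v) (v b)"
    by (simp add: adjoint_works inner_commute)
  also have "inv (frame_map v) (v b) = b"
    using assms b by (metis frame_map_Basis bij_is_inj inv_f_f)
  also have "d \<bullet> b = g b"
    using b by (simp add: d_def)
  finally show "adjoint (inv (frame_map v)) d \<bullet> v b = g b" .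
qed

lemma ball_subset_std_simplex:
  fixes w :: "'a::euclidean_space"
  defines "w \<equiv> \<Sum>b\<in>Basis. (1 / (2 * real DIM('a))) *\<^sub>R b"
  shows "ball w (1 / (2 * real DIM('a))) \<subseteq> convex hull (insert 0 Basis)"
proof
  fix a assume a: "a \<in> ball w (1 / (2 * real DIM('a)))"
  have coord: "\<bar>a \<bullet> b - 1 / (2 * real DIM('a))\<bar> \<le> 1 / (2 * real DIM('a))" if "b \<in> Basis" for b
    using Basis_le_norm[OF that, of "a - w"] a that
    by (simp add: inner_diff_left w_def dist_norm norm_minus_commute)
  have "(\<Sum>b\<in>Basis. a \<bullet> b) \<le> (\<Sum>b\<in>(Basis::'a set). 1 / real DIM('a))"
    using coord by (intro sum_mono) (fastforce simp: abs_le_iff)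
  moreover have "0 \<le> a \<bullet> b" if "b \<in> Basis" for b
    using coord[OF that] by linarith
  ultimately show "a \<in> convex hull (insert 0 Basis)"
    by (simp add: std_simplex)
qed

lemma measure_frame_simplex_ge:
  fixes z :: "'a::euclidean_space \<Rightarrow> 'a"
  assumes r: "0 < r" and z: "\<And>b. b \<in> Basis \<Longrightarrow> norm (z b - x - r *\<^sub>R b) \<le> r / (2 * real DIM('a))"
  shows "unit_ball_vol DIM('a) * (r / (4 * real DIM('a))) ^ DIM('a)
    \<le> measure lebesgue (convex hull (insert x (z ` Basis)))"
proof -
  define v where "v b = z b - x" for b
  define L where "L = frame_map v"
  define w :: 'a where "w = (\<Sum>b\<in>Basis. (1 / (2 * real DIM('a))) *\<^sub>R b)"
  have frame: "norm (v b - r *\<^sub>R b) \<le> r / (2 * real DIM('a))" if "b \<in> Basis" for b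
    using z[OF that] by (simp add: v_def)
  have "linear L" by (simp add: L_def linear_frame_map)
  have "surj L"
    using bij_frame_map[OF r frame] by (simp add: L_def bij_is_surj)
  have image: "(+) x ` L ` (convex hull (insert 0 Basis)) = convex hull (insert x (z ` Basis))"
  proof -
    have "(+) x ` L ` insert 0 Basis = insert x (z ` Basis)"
      using linear_0[OF \<open>linear L\<close>] by (auto simp: L_def frame_map_Basis v_def image_iff)
    thus ?thesis
      by (simp only: convex_hull_linear_image[OF \<open>linear L\<close>] convex_hull_translation[symmetric])
  qed
  have "ball (x + L w) (r / (4 * real DIM('a))) \<subseteq> (+) x ` L ` (convex hull (insert 0 Basis))"
  proof
    fix p assume p: "p \<in> ball (x + L w) (r / (4 * real DIM('a)))"
    obtain a where a: "p = x + L a"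
      using \<open>surj L\<close> by (metis add_diff_cancel_left' add.commute diff_add_cancel surjD)
    have "r * norm (a - w) \<le> 2 * norm (L a - L w)"
      using frame_map_expansive[OF frame, of "a - w"] linear_diff[OF \<open>linear L\<close>] by (simp add: L_def)
    also have "\<dots> < r / (2 * real DIM('a))"
      using p by (simp add: a dist_norm norm_minus_commute field_simps)
    finally have "a \<in> ball w (1 / (2 * real DIM('a)))"
      using r by (simp add: dist_norm norm_minus_commute field_simps)
    hence "a \<in> convex hull (insert 0 Basis)"
      using ball_subset_std_simplex[where 'a='a] by (auto simp: w_def)
    thus "p \<in> (+) x ` L ` (convex hull (insert 0 Basis))"
      using a by blast
  qed
  hence "emeasure lborel (ball (x + L w) (r / (4 * real DIM('a))))
      \<le> emeasure lborel (convex hull (insert x (z ` Basis)))"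
    unfolding image by (intro emeasure_mono) (auto simp: sets_borel_convex_hull_finite)
  thus ?thesis
    using r by (simp add: emeasure_ball emeasure_convex_hull_finite)
qed

definition graph_simplex_const :: "nat \<Rightarrow> real" where
  "graph_simplex_const n = unit_ball_vol n * (1 / (8 * real n)) ^ n / 2"

lemma graph_simplex_const_pos: "0 < n \<Longrightarrow> 0 < graph_simplex_const n"
  by (simp add: graph_simplex_const_def)

lemma graph_simplex_volume_ge:
  fixes f :: "'a::euclidean_space \<Rightarrow> real" and z :: "'a \<Rightarrow> 'a"
  assumes r: "0 < r" and z: "\<And>b. b \<in> Basis \<Longrightarrow> norm (z b - x - r *\<^sub>R b) \<le> r / (2 * real DIM('a))"
  obtains c where "\<And>y. graph_simplex_const DIM('a) * r ^ DIM('a) * \<bar>f y - f x - c \<bullet> (y - x)\<bar>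
      \<le> graph_hull_volume f (insert y (insert x (z ` Basis)))"
proof -
  have "bij (frame_map (\<lambda>b. z b - x))"
    using r z by (rule bij_frame_map)
  from ex_inner_frame_eq[OF this, of "\<lambda>b. f (z b) - f x"]
  obtain c where c: "\<And>b. b \<in> Basis \<Longrightarrow> c \<bullet> (z b - x) = f (z b) - f x"
    by blast
  define g where "g y = f y - (f x - c \<bullet> x + c \<bullet> y)" for y
  have g: "g y = f y - f x - c \<bullet> (y - x)" for y
    by (simp add: g_def inner_diff_right)
  show ?thesis
  proof (rule that[of c])
    fix y
    let ?A = "insert x (z ` Basis)"
    have "graph_simplex_const DIM('a) * r ^ DIM('a) * \<bar>g y\<bar>
        = unit_ball_vol DIM('a) * (r / (4 * real DIM('a))) ^ DIM('a) * \<bar>g y\<bar> / 2 ^ (DIM('a) + 1)"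
    proof -
      have "(r / (4 * real DIM('a))) ^ DIM('a) / 2 ^ DIM('a) = (1 / (8 * real DIM('a))) ^ DIM('a) * r ^ DIM('a)"
        by (simp add: power_divide[symmetric] power_mult_distrib[symmetric])
      hence "graph_simplex_const DIM('a) * r ^ DIM('a)
          = unit_ball_vol DIM('a) * ((r / (4 * real DIM('a))) ^ DIM('a) / 2 ^ DIM('a)) / 2"
        by (simp only: graph_simplex_const_def times_divide_eq_left mult.assoc)
      thus ?thesis by simp
    qed
    also have "\<dots> \<le> measure lebesgue (convex hull ?A) * \<bar>g y\<bar> / 2 ^ (DIM('a) + 1)"
      using measure_frame_simplex_ge[OF r z] by (intro divide_right_mono mult_right_mono) auto
    also have "\<dots> \<le> graph_hull_volume g (insert y ?A)"
      using c by (intro graph_hull_volume_cone_ge) (auto simp: g)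
    also have "\<dots> = graph_hull_volume f (insert y ?A)"
      unfolding g_def by (intro graph_hull_volume_diff_affine) simp
    finally show "graph_simplex_const DIM('a) * r ^ DIM('a) * \<bar>f y - f x - c \<bullet> (y - x)\<bar>
      \<le> graph_hull_volume f (insert y ?A)"
      by (simp add: g)
  qed
qed

subsection \<open>Second differences and convolutions\<close>

definition second_diff :: "('a::euclidean_space \<Rightarrow> real) \<Rightarrow> 'a \<Rightarrow> 'a \<Rightarrow> real" where
  "second_diff f w x = f (x + w) - 2 * f x + f (x - w)"

lemma second_diff_0 [simp]: "second_diff f 0 x = 0"
  by (simp add: second_diff_def)

lemma second_diff_uminus [simp]: "second_diff f (- w) x = second_diff f w x"
  by (simp add: second_diff_def)

lemma second_diff_measurable [measurable]:
  assumes [measurable]: "f \<in> borel_measurable borel"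
    and [measurable]: "g \<in> borel_measurable M" "h \<in> borel_measurable M"
  shows "(\<lambda>z. second_diff f (g z) (h z)) \<in> borel_measurable M"
  unfolding second_diff_def by measurable

lemma cball_borel [measurable]: "cball (a :: 'a::euclidean_space) R \<in> sets borel"
  by simp

lemma ball_borel [measurable]: "ball (a :: 'a::euclidean_space) R \<in> sets borel"
  by simp

definition locally_integrable :: "('a::euclidean_space \<Rightarrow> real) \<Rightarrow> bool" where
  "locally_integrable f \<longleftrightarrow> f \<in> borel_measurable borel \<and> (\<forall>R. set_integrable lborel (cball 0 R) f)"

lemma locally_integrable_measurable:
  "locally_integrable f \<Longrightarrow> f \<in> borel_measurable borel"
  by (simp add: locally_integrable_def)

lemma locally_integrable_const: "locally_integrable (\<lambda>_. c)"
  unfolding locally_integrable_def set_integrable_def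
  by (auto intro!: integrable_scaleR_left integrable_real_indicator emeasure_lborel_cball_finite)

definition bounded_kernel :: "real \<Rightarrow> real \<Rightarrow> ('a::euclidean_space \<Rightarrow> 'b::euclidean_space) \<Rightarrow> bool" where
  "bounded_kernel \<rho> K k \<longleftrightarrow> k \<in> borel_measurable borel \<and> (\<forall>w. norm (k w) \<le> K * indicator (ball 0 \<rho>) w)"

lemma bounded_kernel_measurable:
  "bounded_kernel \<rho> K k \<Longrightarrow> k \<in> borel_measurable borel"
  by (simp add: bounded_kernel_def)

lemma bounded_kernel_norm_le: "bounded_kernel \<rho> K k \<Longrightarrow> norm (k w) \<le> K * indicator (ball 0 \<rho>) w"
  by (simp add: bounded_kernel_def)

definition convolution :: "('a::euclidean_space \<Rightarrow> 'b::euclidean_space) \<Rightarrow> ('a \<Rightarrow> real) \<Rightarrow> 'a \<Rightarrow> 'b" where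
  "convolution k f z = (\<integral>w. f (z - w) *\<^sub>R k w \<partial>lborel)"

lemma integrable_convolution:
  assumes f: "locally_integrable f" and k: "bounded_kernel \<rho> K k"
  shows "integrable lborel (\<lambda>w. f (z - w) *\<^sub>R k w)"
proof -
  note [measurable] = locally_integrable_measurable[OF f] bounded_kernel_measurable[OF k]
  let ?B = "cball 0 (norm z + \<rho>)"
  have "integrable lborel (\<lambda>w. indicator ?B w *\<^sub>R f w)"
    using f by (simp add: locally_integrable_def set_integrable_def)
  hence "integrable lborel (\<lambda>w. indicator ?B (z - w) *\<^sub>R f (z - w))"
    by (subst integrable_lborel_reflect_iff[where g="\<lambda>w. indicator ?B w *\<^sub>R f w"]) measurable
  hence "integrable lborel (\<lambda>w. K * (indicator ?B (z - w) *\<^sub>R f (z - w)))"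
    by simp
  thus ?thesis
  proof (rule Bochner_Integration.integrable_bound)
    show "AE w in lborel. norm (f (z - w) *\<^sub>R k w) \<le> norm (K * (indicator ?B (z - w) *\<^sub>R f (z - w)))"
    proof (rule AE_I2)
      fix w
      show "norm (f (z - w) *\<^sub>R k w) \<le> norm (K * (indicator ?B (z - w) *\<^sub>R f (z - w)))"
      proof (cases "norm w < \<rho>")
        case True
        hence "z - w \<in> ?B"
          using norm_triangle_ineq4[of z w] by simp
        thus ?thesis
          using bounded_kernel_norm_le[OF k, of w] True by (simp add: abs_mult mult.commute mult_right_mono)
      next
        case False
        thus ?thesis using bounded_kernel_norm_le[OF k, of w] by simp
      qed
    qed
  qed measurable
qed

lemma bounded_kernel_integrable:
  assumes "bounded_kernel \<rho> K k"
  shows "integrable lborel k"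
  using integrable_convolution[OF locally_integrable_const[of 1] assms] by simp

lemma bounded_kernel_reflect:
  assumes "bounded_kernel \<rho> K k"
  shows "bounded_kernel \<rho> K (\<lambda>w. k (- w))"
  using bounded_kernel_measurable[OF assms] bounded_kernel_norm_le[OF assms, of "- w" for w]
  by (simp add: bounded_kernel_def indicator_def)

lemma integrable_convolution_reflect:
  assumes f: "locally_integrable f" and k: "bounded_kernel \<rho> K k"
  shows "integrable lborel (\<lambda>w. f (z + w) *\<^sub>R k w)"
proof -
  note [measurable] = locally_integrable_measurable[OF f] bounded_kernel_measurable[OF k]
  have "integrable lborel (\<lambda>w. f (z + (0 - w)) *\<^sub>R k (0 - w))"
    using integrable_convolution[OF f bounded_kernel_reflect[OF k], of z] by simp
  thus ?thesis
    by (subst (asm) integrable_lborel_reflect_iff[where g="\<lambda>w. f (z + w) *\<^sub>R k w"]) measurable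
qed

lemma convolution_reflect:
  assumes f: "locally_integrable f" and k: "bounded_kernel \<rho> K k"
  shows "(\<integral>w. f (z + w) *\<^sub>R k w \<partial>lborel) = convolution (\<lambda>w. k (- w)) f z"
  using integral_lborel_uminus[of "\<lambda>w. f (z + w) *\<^sub>R k w"]
    locally_integrable_measurable[OF f] bounded_kernel_measurable[OF k]
  by (simp add: convolution_def)

lemma convolution_even:
  fixes k :: "'a::euclidean_space \<Rightarrow> real"
  assumes f: "locally_integrable f" and k: "bounded_kernel \<rho> K k" and even: "\<And>w. k (- w) = k w"
  shows "convolution k f z = f z * (\<integral>w. k w \<partial>lborel) + (\<integral>w. k w * second_diff f w z \<partial>lborel) / 2"
proof -
  note int = integrable_convolution[OF f k, of z] integrable_convolution_reflect[OF f k, of z]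
    bounded_kernel_integrable[OF k]
  have "(\<integral>w. k w * second_diff f w z \<partial>lborel)
      = (\<integral>w. (f (z + w) *\<^sub>R k w + f (z - w) *\<^sub>R k w) - 2 * f z * k w \<partial>lborel)"
    by (intro Bochner_Integration.integral_cong) (simp_all add: second_diff_def algebra_simps)
  also have "\<dots> = (\<integral>w. f (z + w) *\<^sub>R k w \<partial>lborel) + convolution k f z - 2 * f z * (\<integral>w. k w \<partial>lborel)"
    using int by (simp add: convolution_def)
  also have "(\<integral>w. f (z + w) *\<^sub>R k w \<partial>lborel) = convolution k f z"
    using convolution_reflect[OF f k] by (simp add: even)
  finally show ?thesis by (simp add: field_simps)
qed

text \<open>Oddness turns the increment of the convolution into a second difference at the midpoint \<open>z + v/2\<close>.\<close>

lemma convolution_odd_increment: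
  fixes k :: "'a::euclidean_space \<Rightarrow> real"
  assumes f: "locally_integrable f" and k: "bounded_kernel \<rho> K k" and odd: "\<And>w. k (- w) = - k w"
  shows "convolution k f (z + v) - convolution k f z
    = (\<integral>w. k w * second_diff f (v /\<^sub>R 2 - w) (z + v /\<^sub>R 2) \<partial>lborel)"
proof -
  note [measurable] = locally_integrable_measurable[OF f] bounded_kernel_measurable[OF k]
  note int = integrable_convolution[OF f k, of "z + v"] integrable_convolution_reflect[OF f k, of z]
    bounded_kernel_integrable[OF k]
  have "(\<integral>w. k w \<partial>lborel) = - (\<integral>w. k w \<partial>lborel)"
    using integral_lborel_uminus[of k] by (simp add: odd)
  hence mean_zero: "(\<integral>w. k w \<partial>lborel) = 0" by simp
  have midpoint: "z + v /\<^sub>R 2 + (v /\<^sub>R 2 - w) = z + v - w" "z + v /\<^sub>R 2 - (v /\<^sub>R 2 - w) = z + w" for w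
    by (simp_all add: algebra_simps flip: scaleR_add_left)
  have "(\<integral>w. k w * second_diff f (v /\<^sub>R 2 - w) (z + v /\<^sub>R 2) \<partial>lborel)
      = (\<integral>w. (f (z + v - w) *\<^sub>R k w + f (z + w) *\<^sub>R k w) - 2 * f (z + v /\<^sub>R 2) * k w \<partial>lborel)"
    unfolding second_diff_def midpoint
    by (intro Bochner_Integration.integral_cong) (simp_all add: algebra_simps)
  also have "\<dots> = convolution k f (z + v) + (\<integral>w. f (z + w) *\<^sub>R k w \<partial>lborel)"
    using int by (simp add: convolution_def mean_zero)
  also have "(\<integral>w. f (z + w) *\<^sub>R k w \<partial>lborel) = - convolution k f z"
    unfolding convolution_reflect[OF f k] by (simp add: convolution_def odd)
  finally show ?thesis by simp
qed

definition second_diff_mean :: "('a::euclidean_space \<Rightarrow> real) \<Rightarrow> real \<Rightarrow> real \<Rightarrow> 'a \<Rightarrow> ennreal" where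
  "second_diff_mean f p r x = (\<integral>\<^sup>+w\<in>ball 0 r. ennreal (\<bar>second_diff f w x\<bar> powr p) \<partial>lborel)"

lemma indicator_ball_eq: "indicator (ball a r) b = (if dist a b < r then 1 else 0 :: ennreal)"
  by (simp add: indicator_def)

lemma second_diff_mean_measurable [measurable]:
  fixes f :: "'a::euclidean_space \<Rightarrow> real"
  assumes [measurable]: "f \<in> borel_measurable borel" "g \<in> borel_measurable M" "h \<in> borel_measurable M"
  shows "(\<lambda>z. second_diff_mean f p (g z) (h z)) \<in> borel_measurable M"
  unfolding second_diff_mean_def indicator_ball_eq by measurable

lemma second_diff_mean_mono_radius:
  assumes "r \<le> r'"
  shows "second_diff_mean f p r x \<le> second_diff_mean f p r' x"
  unfolding second_diff_mean_def using assms
  by (intro nn_integral_mono mult_left_mono) (auto simp: indicator_def)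

lemma ennreal_norm_integral_le: "ennreal (norm (\<integral>x. g x \<partial>M)) \<le> (\<integral>\<^sup>+x. ennreal (norm (g x)) \<partial>M)"
  by (cases "integrable M g") (simp_all add: integral_norm_bound_ennreal not_integrable_integral_eq)

lemma abs_integral_kernel_second_diff_le:
  fixes k :: "'a::euclidean_space \<Rightarrow> real"
  assumes [measurable]: "f \<in> borel_measurable borel" and k: "bounded_kernel \<rho> K k" and "0 \<le> K"
  shows "ennreal \<bar>\<integral>w. k w * second_diff f (u - w) z \<partial>lborel\<bar> \<le> ennreal K * second_diff_mean f 1 (\<rho> + norm u) z"
proof -
  have "ennreal \<bar>\<integral>w. k w * second_diff f (u - w) z \<partial>lborel\<bar>
      \<le> (\<integral>\<^sup>+w. ennreal (norm (k w * second_diff f (u - w) z)) \<partial>lborel)"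
    using ennreal_norm_integral_le[of lborel "\<lambda>w. k w * second_diff f (u - w) z"] by simp
  also have "\<dots> \<le> (\<integral>\<^sup>+w. ennreal K * (ennreal (\<bar>second_diff f (u - w) z\<bar> powr 1)
      * indicator (ball 0 (\<rho> + norm u)) (u - w)) \<partial>lborel)"
  proof (rule nn_integral_mono)
    fix w :: 'a
    show "ennreal (norm (k w * second_diff f (u - w) z))
      \<le> ennreal K * (ennreal (\<bar>second_diff f (u - w) z\<bar> powr 1) * indicator (ball 0 (\<rho> + norm u)) (u - w))"
    proof (cases "norm w < \<rho>")
      case True
      hence "norm (u - w) < \<rho> + norm u"
        using norm_triangle_ineq4[of u w] by linarith
      thus ?thesis
        using bounded_kernel_norm_le[OF k, of w] True \<open>0 \<le> K\<close>
        by (simp add: abs_mult ennreal_mult[symmetric] ennreal_leI mult_right_mono)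
    next
      case False
      thus ?thesis using bounded_kernel_norm_le[OF k, of w] by simp
    qed
  qed
  also have "\<dots> = ennreal K * (\<integral>\<^sup>+w. ennreal (\<bar>second_diff f (u - w) z\<bar> powr 1)
      * indicator (ball 0 (\<rho> + norm u)) (u - w) \<partial>lborel)"
    by (rule nn_integral_cmult) measurable
  also have "\<dots> = ennreal K * second_diff_mean f 1 (\<rho> + norm u) z"
    unfolding second_diff_mean_def
    by (subst nn_integral_lborel_reflect[where g="\<lambda>w. ennreal (\<bar>second_diff f w z\<bar> powr 1)
      * indicator (ball 0 (\<rho> + norm u)) w"])
      measurable
  finally show ?thesis .
qed

subsection \<open>Affine approximation by mollification\<close>

definition bump :: "real \<Rightarrow> 'a::euclidean_space \<Rightarrow> real" where
  "bump \<rho> w = (max 0 (1 - (w \<bullet> w) / \<rho>\<^sup>2))\<^sup>2"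

definition bump_gradient :: "real \<Rightarrow> 'a::euclidean_space \<Rightarrow> 'a" where
  "bump_gradient \<rho> w = (- 4 * max 0 (1 - (w \<bullet> w) / \<rho>\<^sup>2) / \<rho>\<^sup>2) *\<^sub>R w"

lemma bump_uminus: "bump \<rho> (- w) = bump \<rho> w"
  by (simp add: bump_def)

lemma bump_gradient_uminus: "bump_gradient \<rho> (- w) = - bump_gradient \<rho> w"
  by (simp add: bump_gradient_def)

lemma truncated_paraboloid_eq_0:
  fixes w :: "'a::euclidean_space"
  assumes "0 < \<rho>" "w \<notin> ball 0 \<rho>"
  shows "max 0 (1 - (w \<bullet> w) / \<rho>\<^sup>2) = 0"
proof -
  have "\<rho>\<^sup>2 \<le> w \<bullet> w"
    using assms by (simp add: dot_square_norm)
  thus ?thesis using assms by (simp add: field_simps)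
qed

lemma bounded_kernel_bump:
  assumes "0 < \<rho>"
  shows "bounded_kernel \<rho> 1 (bump \<rho>)"
  unfolding bounded_kernel_def
proof (intro conjI allI)
  show "bump \<rho> \<in> borel_measurable borel"
    unfolding bump_def[abs_def] by measurable
  show "norm (bump \<rho> w) \<le> 1 * indicator (ball 0 \<rho>) w" for w :: 'a
  proof (cases "w \<in> ball 0 \<rho>")
    case False
    thus ?thesis by (simp add: bump_def truncated_paraboloid_eq_0[OF assms])
  next
    case True
    thus ?thesis by (simp add: bump_def power_le_one)
  qed
qed

lemma bounded_kernel_bump_gradient:
  assumes "0 < \<rho>"
  shows "bounded_kernel \<rho> (4 / \<rho>) (bump_gradient \<rho>)"
  unfolding bounded_kernel_def
proof (intro conjI allI)
  show "bump_gradient \<rho> \<in> borel_measurable borel"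
    unfolding bump_gradient_def[abs_def] by measurable
  show "norm (bump_gradient \<rho> w) \<le> 4 / \<rho> * indicator (ball 0 \<rho>) w" for w :: 'a
  proof (cases "w \<in> ball 0 \<rho>")
    case False
    thus ?thesis by (simp add: bump_gradient_def truncated_paraboloid_eq_0[OF assms])
  next
    case True
    let ?m = "max 0 (1 - (w \<bullet> w) / \<rho>\<^sup>2)"
    have "norm (bump_gradient \<rho> w) = 4 * ?m / \<rho>\<^sup>2 * norm w"
      by (simp add: bump_gradient_def abs_mult)
    also have "\<dots> \<le> 4 * 1 / \<rho>\<^sup>2 * \<rho>"
      using True assms by (intro mult_mono divide_right_mono mult_left_mono) auto
    finally show ?thesis using True assms by (simp add: power2_eq_square)
  qed
qed

lemma has_real_derivative_pos_part_square:
  "((\<lambda>u::real. (max 0 u)\<^sup>2) has_real_derivative 2 * max 0 u) (at u)"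
proof (cases u "0::real" rule: linorder_cases)
  case less
  have "((\<lambda>u::real. 0) has_real_derivative 0) (at u)" by simp
  hence "((\<lambda>u::real. (max 0 u)\<^sup>2) has_real_derivative 0) (at u)"
    by (rule has_field_derivative_transform_within_open[of _ _ _ "{..<0}"]) (use less in auto)
  thus ?thesis using less by simp
next
  case greater
  have "((\<lambda>u::real. u\<^sup>2) has_real_derivative 2 * u) (at u)"
    by (auto intro!: derivative_eq_intros)
  hence "((\<lambda>u::real. (max 0 u)\<^sup>2) has_real_derivative 2 * u) (at u)"
    by (rule has_field_derivative_transform_within_open[of _ _ _ "{0<..}"]) (use greater in auto)
  thus ?thesis using greater by simp
next
  case equal
  have "((\<lambda>h::real. (max 0 h)\<^sup>2 / h) \<longlongrightarrow> 0) (at 0)"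
  proof (rule Lim_null_comparison)
    have "norm ((max 0 h)\<^sup>2 / h) \<le> \<bar>h\<bar>" for h :: real
      by (cases "0 < h") (simp_all add: power2_eq_square)
    thus "\<forall>\<^sub>F h::real in at 0. norm ((max 0 h)\<^sup>2 / h) \<le> \<bar>h\<bar>"
      by simp
    show "((\<lambda>h::real. \<bar>h\<bar>) \<longlongrightarrow> 0) (at 0)"
      by (rule tendsto_eq_intros refl | simp)+
  qed
  thus ?thesis using equal by (simp add: DERIV_def)
qed

lemma has_real_derivative_bump:
  fixes w y :: "'a::euclidean_space"
  shows "((\<lambda>t. bump \<rho> (w + t *\<^sub>R y)) has_real_derivative bump_gradient \<rho> (w + t *\<^sub>R y) \<bullet> y) (at t)"
proof -
  define u where "u t = 1 - ((w + t *\<^sub>R y) \<bullet> (w + t *\<^sub>R y)) / \<rho>\<^sup>2" for t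
  have u_eq: "u = (\<lambda>t. 1 - (w \<bullet> w + 2 * t * (w \<bullet> y) + t\<^sup>2 * (y \<bullet> y)) / \<rho>\<^sup>2)"
    by (auto simp: u_def inner_add_left inner_add_right inner_commute algebra_simps power2_eq_square)
  have "(u has_real_derivative - 2 * ((w + t *\<^sub>R y) \<bullet> y) / \<rho>\<^sup>2) (at t)"
    unfolding u_eq divide_inverse
    by (rule derivative_eq_intros refl)+ (simp add: inner_add_left algebra_simps)
  from DERIV_chain2[OF has_real_derivative_pos_part_square this]
  show ?thesis
    by (simp add: bump_def bump_gradient_def u_def mult_ac)
qed

lemma bump_increment:
  fixes w y :: "'a::euclidean_space"
  assumes "0 < \<rho>"
  shows "bump \<rho> (w + y) - bump \<rho> w
    = (\<integral>t. (bump_gradient \<rho> (w + t *\<^sub>R y) \<bullet> y) * indicator {0..1} t \<partial>lborel)"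
proof -
  have "(\<integral>t. (bump_gradient \<rho> (w + t *\<^sub>R y) \<bullet> y) * indicator {0..1} t \<partial>lborel)
      = bump \<rho> (w + 1 *\<^sub>R y) - bump \<rho> (w + 0 *\<^sub>R y)"
    unfolding bump_gradient_def using assms
    by (intro integral_FTC_Icc_real has_real_derivative_bump[unfolded bump_gradient_def])
      (auto intro!: continuous_intros)
  thus ?thesis by simp
qed

lemma abs_bump_gradient_inner_le:
  fixes w y :: "'a::euclidean_space"
  assumes \<rho>: "0 < \<rho>" and t: "0 \<le> t" "t \<le> 1"
  shows "\<bar>bump_gradient \<rho> (w + t *\<^sub>R y) \<bullet> y\<bar> \<le> 4 / \<rho> * norm y * indicator (ball 0 (\<rho> + norm y)) w"
proof -
  have "norm w \<le> norm (w + t *\<^sub>R y) + norm (t *\<^sub>R y)"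
    using norm_triangle_ineq4[of "w + t *\<^sub>R y" "t *\<^sub>R y"] by simp
  also have "norm (t *\<^sub>R y) \<le> norm y"
    using t by (simp add: mult_left_le_one_le)
  finally have "indicator (ball 0 \<rho>) (w + t *\<^sub>R y) \<le> (indicator (ball 0 (\<rho> + norm y)) w :: real)"
    by (auto simp: indicator_def)
  hence "norm (bump_gradient \<rho> (w + t *\<^sub>R y)) \<le> 4 / \<rho> * indicator (ball 0 (\<rho> + norm y)) w"
    using \<rho> by (intro order_trans[OF bounded_kernel_norm_le[OF bounded_kernel_bump_gradient[OF \<rho>]]]
      mult_left_mono) auto
  hence "\<bar>bump_gradient \<rho> (w + t *\<^sub>R y) \<bullet> y\<bar> \<le> 4 / \<rho> * indicator (ball 0 (\<rho> + norm y)) w * norm y"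
    by (intro order_trans[OF Cauchy_Schwarz_ineq2] mult_right_mono) auto
  thus ?thesis by (simp only: mult_ac)
qed

lemma integrable_bump_gradient_segment:
  fixes f :: "'a::euclidean_space \<Rightarrow> real"
  assumes f: "locally_integrable f" and \<rho>: "0 < \<rho>"
  shows "integrable (lborel \<Otimes>\<^sub>M lborel)
    (\<lambda>(w, t). (bump_gradient \<rho> (w + t *\<^sub>R y) \<bullet> y) * indicator {0..1} t * f (z - w))"
proof (rule integrableI_bounded)
  note [measurable] = locally_integrable_measurable[OF f]
    bounded_kernel_measurable[OF bounded_kernel_bump_gradient[OF \<rho>]]
  let ?K = "4 / \<rho> * norm y"
  let ?k = "\<lambda>w. ?K * indicator (ball 0 (\<rho> + norm y)) w"
  let ?G = "\<lambda>w t. (bump_gradient \<rho> (w + t *\<^sub>R y) \<bullet> y) * indicator {0..1} t * f (z - w)"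
  show [measurable]: "(\<lambda>(w, t). ?G w t) \<in> borel_measurable (lborel \<Otimes>\<^sub>M lborel)"
    by measurable
  have "bounded_kernel (\<rho> + norm y) ?K ?k"
    using \<rho> by (simp add: bounded_kernel_def abs_mult)
  from integrable_convolution[OF f this]
  have dominated: "integrable lborel (\<lambda>w. f (z - w) *\<^sub>R ?k w)" .
  have G_le: "norm (?G w t) \<le> norm (f (z - w) *\<^sub>R ?k w) * indicator {0..1} t" for w t
  proof (cases "t \<in> {0..1}")
    case True
    hence "\<bar>bump_gradient \<rho> (w + t *\<^sub>R y) \<bullet> y\<bar> * \<bar>f (z - w)\<bar> \<le> ?k w * \<bar>f (z - w)\<bar>"
      by (intro mult_right_mono abs_bump_gradient_inner_le \<rho>) simp_all
    thus ?thesis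
      using True \<rho> by (simp add: abs_mult mult_ac)
  qed simp
  have "(\<integral>\<^sup>+q. ennreal (norm (case q of (w, t) \<Rightarrow> ?G w t)) \<partial>(lborel \<Otimes>\<^sub>M lborel))
      = (\<integral>\<^sup>+w. (\<integral>\<^sup>+t. ennreal (norm (?G w t)) \<partial>lborel) \<partial>lborel)"
    by (subst lborel.nn_integral_fst[symmetric]) (simp_all add: split_beta')
  also have "\<dots> \<le> (\<integral>\<^sup>+w. (\<integral>\<^sup>+t. ennreal (norm (f (z - w) *\<^sub>R ?k w)) * indicator {0..1::real} t \<partial>lborel) \<partial>lborel)"
  proof (intro nn_integral_mono)
    fix w :: 'a and t :: real
    show "ennreal (norm (?G w t)) \<le> ennreal (norm (f (z - w) *\<^sub>R ?k w)) * indicator {0..1} t"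
      using ennreal_leI[OF G_le[of w t]] by (cases "t \<in> {0..1}") simp_all
  qed
  also have "\<dots> = (\<integral>\<^sup>+w. ennreal (norm (f (z - w) *\<^sub>R ?k w)) \<partial>lborel)"
    by (simp add: nn_integral_cmult_indicator)
  also have "\<dots> < \<infinity>"
    using dominated unfolding integrable_iff_bounded by blast
  finally show "(\<integral>\<^sup>+q. ennreal (norm (case q of (w, t) \<Rightarrow> ?G w t)) \<partial>(lborel \<Otimes>\<^sub>M lborel)) < \<infinity>" .
qed

lemma convolution_bump_gradient_translate:
  fixes f :: "'a::euclidean_space \<Rightarrow> real"
  assumes f: "locally_integrable f" and \<rho>: "0 < \<rho>"
  shows "(\<integral>w. (bump_gradient \<rho> (w + u) \<bullet> y) * f (z - w) \<partial>lborel) = convolution (bump_gradient \<rho>) f (z + u) \<bullet> y"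
proof -
  note kernel = bounded_kernel_bump_gradient[OF \<rho>, where 'a='a]
  note [measurable] = locally_integrable_measurable[OF f] bounded_kernel_measurable[OF kernel]
  have "(\<integral>w. (bump_gradient \<rho> (w + u) \<bullet> y) * f (z - w) \<partial>lborel)
      = (\<integral>w. (f (z + u - (u + w)) *\<^sub>R bump_gradient \<rho> (u + w)) \<bullet> y \<partial>lborel)"
    by (simp add: algebra_simps)
  also have "\<dots> = (\<integral>w. (f (z + u - w) *\<^sub>R bump_gradient \<rho> w) \<bullet> y \<partial>lborel)"
    by (rule integral_lborel_translate[where g="\<lambda>w. (f (z + u - w) *\<^sub>R bump_gradient \<rho> w) \<bullet> y"]) measurable
  also have "\<dots> = convolution (bump_gradient \<rho>) f (z + u) \<bullet> y"
    unfolding convolution_def using integrable_convolution[OF f kernel] by (rule integral_inner_left)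
  finally show ?thesis .
qed

lemma convolution_bump_increment:
  fixes f :: "'a::euclidean_space \<Rightarrow> real"
  assumes f: "locally_integrable f" and \<rho>: "0 < \<rho>"
  shows "integrable lborel (\<lambda>t. (convolution (bump_gradient \<rho>) f (z + t *\<^sub>R y) \<bullet> y) * indicator {0..1} t)"
    and "convolution (bump \<rho>) f (z + y) - convolution (bump \<rho>) f z
      = (\<integral>t. (convolution (bump_gradient \<rho>) f (z + t *\<^sub>R y) \<bullet> y) * indicator {0..1} t \<partial>lborel)"
proof -
  note [measurable] = locally_integrable_measurable[OF f]
    bounded_kernel_measurable[OF bounded_kernel_bump[OF \<rho>]]
  let ?G = "\<lambda>w t. (bump_gradient \<rho> (w + t *\<^sub>R y) \<bullet> y) * indicator {0..1} t * f (z - w)"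
  note G = integrable_bump_gradient_segment[OF f \<rho>, of y z]
  have over_w: "(\<integral>w. ?G w t \<partial>lborel)
      = (convolution (bump_gradient \<rho>) f (z + t *\<^sub>R y) \<bullet> y) * indicator {0..1} t" for t
  proof -
    have "(\<integral>w. ?G w t \<partial>lborel) = (\<integral>w. ((bump_gradient \<rho> (w + t *\<^sub>R y) \<bullet> y) * f (z - w))
        * indicator {0..1} t \<partial>lborel)"
      by (simp add: mult_ac)
    thus ?thesis
      by (simp add: convolution_bump_gradient_translate[OF f \<rho>])
  qed
  have over_t: "(\<integral>t. ?G w t \<partial>lborel) = (bump \<rho> (w + y) - bump \<rho> w) * f (z - w)" for w
    by (simp add: bump_increment[OF \<rho>])
  show "integrable lborel (\<lambda>t. (convolution (bump_gradient \<rho>) f (z + t *\<^sub>R y) \<bullet> y) * indicator {0..1} t)"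
    using lborel_pair.integrable_snd[OF G] by (simp add: over_w)
  have "integrable lborel (\<lambda>w. (bump \<rho> (w + y) - bump \<rho> w) * f (z - w))"
    using lborel_pair.integrable_fst'[OF G] by (simp add: bump_increment[OF \<rho>])
  hence "(\<integral>w. (bump \<rho> (w + y) - bump \<rho> w) * f (z - w) \<partial>lborel) + convolution (bump \<rho>) f z
      = (\<integral>w. f (z - w) * bump \<rho> (w + y) \<partial>lborel)"
    using integrable_convolution[OF f bounded_kernel_bump[OF \<rho>], of z]
    by (subst convolution_def, subst Bochner_Integration.integral_add[symmetric])
      (auto intro!: Bochner_Integration.integral_cong simp: algebra_simps)
  also have "\<dots> = convolution (bump \<rho>) f (z + y)"
    using integral_lborel_translate[of "\<lambda>w. f (z + y - w) * bump \<rho> w" y]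
    by (simp add: convolution_def add.commute)
  finally have "convolution (bump \<rho>) f (z + y) - convolution (bump \<rho>) f z = (\<integral>w. (\<integral>t. ?G w t \<partial>lborel) \<partial>lborel)"
    unfolding over_t by linarith
  also have "\<dots> = (\<integral>t. (\<integral>w. ?G w t \<partial>lborel) \<partial>lborel)"
    by (rule lborel_pair.Fubini_integral[OF G, symmetric])
  finally show "convolution (bump \<rho>) f (z + y) - convolution (bump \<rho>) f z
      = (\<integral>t. (convolution (bump_gradient \<rho>) f (z + t *\<^sub>R y) \<bullet> y) * indicator {0..1} t \<partial>lborel)"
    by (simp add: over_w)
qed

lemma convolution_bump_gradient_increment_le:
  fixes f :: "'a::euclidean_space \<Rightarrow> real"
  assumes f: "locally_integrable f" and \<rho>: "0 < \<rho>" and y: "norm y \<le> 2 * \<rho>" and v: "norm v \<le> 2 * \<rho>"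
  shows "ennreal \<bar>(convolution (bump_gradient \<rho>) f (z + v) - convolution (bump_gradient \<rho>) f z) \<bullet> y\<bar>
    \<le> 8 * second_diff_mean f 1 (2 * \<rho>) (z + v /\<^sub>R 2)"
proof -
  note gradient = bounded_kernel_bump_gradient[OF \<rho>, where 'a='a]
  let ?k = "\<lambda>w. bump_gradient \<rho> w \<bullet> y"
  have k: "bounded_kernel \<rho> 8 ?k"
    unfolding bounded_kernel_def
  proof (intro conjI allI)
    show "?k \<in> borel_measurable borel"
      using bounded_kernel_measurable[OF gradient] by measurable
    fix w
    have "norm (?k w) \<le> norm (bump_gradient \<rho> w) * norm y"
      by (simp add: Cauchy_Schwarz_ineq2)
    also have "\<dots> \<le> (4 / \<rho> * indicator (ball 0 \<rho>) w) * (2 * \<rho>)"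
      using \<rho> y by (intro mult_mono bounded_kernel_norm_le[OF gradient]) auto
    finally show "norm (?k w) \<le> 8 * indicator (ball 0 \<rho>) w"
      using \<rho> by simp
  qed
  have "convolution (bump_gradient \<rho>) f u \<bullet> y = convolution ?k f u" for u
    using integrable_convolution[OF f gradient, of u]
    by (simp add: convolution_def flip: integral_inner_left)
  hence "(convolution (bump_gradient \<rho>) f (z + v) - convolution (bump_gradient \<rho>) f z) \<bullet> y
      = (\<integral>w. ?k w * second_diff f (v /\<^sub>R 2 - w) (z + v /\<^sub>R 2) \<partial>lborel)"
    using convolution_odd_increment[OF f k] by (simp add: inner_diff_left bump_gradient_uminus)
  hence "ennreal \<bar>(convolution (bump_gradient \<rho>) f (z + v) - convolution (bump_gradient \<rho>) f z) \<bullet> y\<bar>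
      \<le> ennreal 8 * second_diff_mean f 1 (\<rho> + norm (v /\<^sub>R 2)) (z + v /\<^sub>R 2)"
    using abs_integral_kernel_second_diff_le[OF locally_integrable_measurable[OF f] k,
      of "v /\<^sub>R 2" "z + v /\<^sub>R 2"] by simp
  also have "\<dots> \<le> 8 * second_diff_mean f 1 (2 * \<rho>) (z + v /\<^sub>R 2)"
    using v by (intro mult_mono second_diff_mean_mono_radius) auto
  finally show ?thesis .
qed

lemma convolution_bump_remainder_le:
  fixes f :: "'a::euclidean_space \<Rightarrow> real"
  assumes f: "locally_integrable f" and \<rho>: "0 < \<rho>" and y: "norm y \<le> 2 * \<rho>"
  shows "ennreal \<bar>convolution (bump \<rho>) f (z + y) - convolution (bump \<rho>) f z
    - convolution (bump_gradient \<rho>) f z \<bullet> y\<bar>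
    \<le> 8 * (\<integral>\<^sup>+t\<in>{0..1}. second_diff_mean f 1 (2 * \<rho>) (z + (t / 2) *\<^sub>R y) \<partial>lborel)"
proof -
  note [measurable] = locally_integrable_measurable[OF f]
  let ?g = "\<lambda>t::real. convolution (bump_gradient \<rho>) f (z + t *\<^sub>R y)"
    and ?slope = "convolution (bump_gradient \<rho>) f z"
  note increment = convolution_bump_increment[OF f \<rho>, of z y]
  have "convolution (bump \<rho>) f (z + y) - convolution (bump \<rho>) f z - ?slope \<bullet> y
      = (\<integral>t. (?g t \<bullet> y) * indicator {0..1} t \<partial>lborel) - (\<integral>t. (?slope \<bullet> y) * indicator {0..1::real} t \<partial>lborel)"
    by (simp add: increment(2))
  also have "\<dots> = (\<integral>t. (?g t \<bullet> y) * indicator {0..1} t - (?slope \<bullet> y) * indicator {0..1::real} t \<partial>lborel)"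
    using increment(1) by (intro Bochner_Integration.integral_diff[symmetric]) auto
  also have "\<dots> = (\<integral>t. ((?g t - ?slope) \<bullet> y) * indicator {0..1} t \<partial>lborel)"
    by (simp add: inner_diff_left left_diff_distrib)
  finally have "ennreal \<bar>convolution (bump \<rho>) f (z + y) - convolution (bump \<rho>) f z - ?slope \<bullet> y\<bar>
      \<le> (\<integral>\<^sup>+t. ennreal (norm (((?g t - ?slope) \<bullet> y) * indicator {0..1} t)) \<partial>lborel)"
    using ennreal_norm_integral_le[of lborel "\<lambda>t. ((?g t - ?slope) \<bullet> y) * indicator {0..1} t"] by simp
  also have "\<dots> \<le> (\<integral>\<^sup>+t. 8 * (second_diff_mean f 1 (2 * \<rho>) (z + (t / 2) *\<^sub>R y) * indicator {0..1} t) \<partial>lborel)"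
  proof (rule nn_integral_mono)
    fix t :: real
    show "ennreal (norm (((?g t - ?slope) \<bullet> y) * indicator {0..1} t))
      \<le> 8 * (second_diff_mean f 1 (2 * \<rho>) (z + (t / 2) *\<^sub>R y) * indicator {0..1} t)"
    proof (cases "t \<in> {0..1}")
      case True
      hence "norm (t *\<^sub>R y) \<le> 2 * \<rho>"
        using y mult_left_le_one_le[of "norm y" t] by simp
      moreover have "(t *\<^sub>R y) /\<^sub>R 2 = (t / 2) *\<^sub>R y"
        by simp
      ultimately show ?thesis
        using convolution_bump_gradient_increment_le[OF f \<rho> y, of "t *\<^sub>R y" z] True by simp
    qed simp
  qed
  also have "\<dots> = 8 * (\<integral>\<^sup>+t\<in>{0..1}. second_diff_mean f 1 (2 * \<rho>) (z + (t / 2) *\<^sub>R y) \<partial>lborel)"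
    by (rule nn_integral_cmult) measurable
  finally show ?thesis .
qed

lemma convolution_bump_error_le:
  fixes f :: "'a::euclidean_space \<Rightarrow> real"
  assumes f: "locally_integrable f" and \<rho>: "0 < \<rho>"
  shows "ennreal \<bar>f x * (\<integral>w. bump \<rho> w \<partial>(lborel :: 'a measure)) - convolution (bump \<rho>) f x\<bar>
    \<le> second_diff_mean f 1 \<rho> x"
proof -
  note kernel = bounded_kernel_bump[OF \<rho>, where 'a='a]
  let ?S = "\<integral>w. bump \<rho> w * second_diff f w x \<partial>lborel"
  have "\<bar>f x * (\<integral>w. bump \<rho> w \<partial>(lborel :: 'a measure)) - convolution (bump \<rho>) f x\<bar> \<le> \<bar>?S\<bar>"
    by (simp add: convolution_even[OF f kernel bump_uminus])
  moreover have "ennreal \<bar>?S\<bar> \<le> second_diff_mean f 1 \<rho> x"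
    using abs_integral_kernel_second_diff_le[OF locally_integrable_measurable[OF f] kernel, of 0 x] by simp
  ultimately show ?thesis
    using ennreal_leI order_trans by blast
qed

lemma integral_bump_ge:
  assumes "0 < \<rho>"
  shows "9 / 16 * (unit_ball_vol DIM('a) * (\<rho> / 2) ^ DIM('a))
    \<le> (\<integral>w. bump \<rho> w \<partial>(lborel :: 'a::euclidean_space measure))"
proof -
  have "9 / 16 * (unit_ball_vol DIM('a) * (\<rho> / 2) ^ DIM('a))
      = (\<integral>w. 9 / 16 * indicator (cball 0 (\<rho> / 2)) w \<partial>(lborel :: 'a measure))"
    using assms by (simp add: content_cball)
  also have "\<dots> \<le> (\<integral>w. bump \<rho> w \<partial>(lborel :: 'a measure))"
  proof (rule integral_mono)
    fix w :: 'a
    show "9 / 16 * indicator (cball 0 (\<rho> / 2)) w \<le> bump \<rho> w"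
    proof (cases "w \<in> cball 0 (\<rho> / 2)")
      case True
      hence "(norm w)\<^sup>2 \<le> (\<rho> / 2)\<^sup>2" by (intro power_mono) auto
      hence "(w \<bullet> w) / \<rho>\<^sup>2 \<le> 1 / 4"
        using assms by (simp add: dot_square_norm field_simps)
      hence "(3 / 4)\<^sup>2 \<le> bump \<rho> w"
        unfolding bump_def by (intro power_mono) linarith+
      thus ?thesis using True by (simp add: power2_eq_square)
    qed (simp add: bump_def)
  next
    show "integrable lborel (\<lambda>w::'a. 9 / 16 * indicator (cball 0 (\<rho> / 2)) w :: real)"
      by (intro integrable_mult_right integrable_real_indicator emeasure_lborel_cball_finite) auto
  qed (rule bounded_kernel_integrable[OF bounded_kernel_bump[OF assms]])
  finally show ?thesis .
qed

definition second_diff_control :: "('a::euclidean_space \<Rightarrow> real) \<Rightarrow> real \<Rightarrow> real \<Rightarrow> 'a \<Rightarrow> 'a \<Rightarrow> ennreal" where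
  "second_diff_control f p r x\<^sub>0 x = second_diff_mean f p r x
     + (\<integral>\<^sup>+t\<in>{0..1}. second_diff_mean f p r (x\<^sub>0 + (t / 2) *\<^sub>R (x - x\<^sub>0)) \<partial>lborel)"

lemma bump_affine_error_le:
  fixes f :: "'a::euclidean_space \<Rightarrow> real" and x\<^sub>0 :: 'a
  assumes f: "locally_integrable f" and r: "0 < r" and x: "norm (x - x\<^sub>0) \<le> r"
  defines "F \<equiv> convolution (bump (r / 2)) f" and "g \<equiv> convolution (bump_gradient (r / 2)) f x\<^sub>0"
    and "B \<equiv> \<integral>w. bump (r / 2) w \<partial>(lborel :: 'a measure)"
  shows "ennreal \<bar>f x * B - (F x\<^sub>0 + g \<bullet> (x - x\<^sub>0))\<bar> \<le> 8 * second_diff_control f 1 r x\<^sub>0 x"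
proof -
  have \<rho>: "0 < r / 2" using r by simp
  have "ennreal \<bar>f x * B - F x\<bar> \<le> second_diff_mean f 1 (r / 2) x"
    unfolding B_def F_def by (rule convolution_bump_error_le[OF f \<rho>])
  also have "\<dots> \<le> 1 * second_diff_mean f 1 r x"
    using r by (simp add: second_diff_mean_mono_radius)
  also have "\<dots> \<le> 8 * second_diff_mean f 1 r x"
    by (rule mult_right_mono) auto
  finally have error: "ennreal \<bar>f x * B - F x\<bar> \<le> 8 * second_diff_mean f 1 r x" .
  have remainder: "ennreal \<bar>F x - F x\<^sub>0 - g \<bullet> (x - x\<^sub>0)\<bar>
      \<le> 8 * (\<integral>\<^sup>+t\<in>{0..1}. second_diff_mean f 1 r (x\<^sub>0 + (t / 2) *\<^sub>R (x - x\<^sub>0)) \<partial>lborel)"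
    using convolution_bump_remainder_le[OF f \<rho>, of "x - x\<^sub>0" x\<^sub>0] x by (simp add: F_def g_def)
  have "\<bar>f x * B - (F x\<^sub>0 + g \<bullet> (x - x\<^sub>0))\<bar> \<le> \<bar>f x * B - F x\<bar> + \<bar>F x - F x\<^sub>0 - g \<bullet> (x - x\<^sub>0)\<bar>"
    by linarith
  hence "ennreal \<bar>f x * B - (F x\<^sub>0 + g \<bullet> (x - x\<^sub>0))\<bar>
      \<le> ennreal (\<bar>f x * B - F x\<bar> + \<bar>F x - F x\<^sub>0 - g \<bullet> (x - x\<^sub>0)\<bar>)"
    by (rule ennreal_leI)
  also have "\<dots> = ennreal \<bar>f x * B - F x\<bar> + ennreal \<bar>F x - F x\<^sub>0 - g \<bullet> (x - x\<^sub>0)\<bar>"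
    by (rule ennreal_plus) simp_all
  also have "\<dots> \<le> 8 * second_diff_control f 1 r x\<^sub>0 x"
    unfolding second_diff_control_def distrib_left by (rule add_mono[OF error remainder])
  finally show ?thesis .
qed

definition affine_approx_const :: "nat \<Rightarrow> real" where
  "affine_approx_const n = 128 / 9 * 4 ^ n / unit_ball_vol n"

lemma affine_approximation:
  fixes f :: "'a::euclidean_space \<Rightarrow> real"
  assumes f: "locally_integrable f" and r: "0 < r"
  obtains a c where "\<And>x. norm (x - x\<^sub>0) \<le> r \<Longrightarrow>
    ennreal \<bar>f x - (a + c \<bullet> x)\<bar> \<le> ennreal (affine_approx_const DIM('a) / r ^ DIM('a))
        * second_diff_control f 1 r x\<^sub>0 x"
proof -
  define B where "B = (\<integral>w. bump (r / 2) w \<partial>(lborel :: 'a measure))"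
  define F where "F = convolution (bump (r / 2)) f"
  define g where "g = convolution (bump_gradient (r / 2)) f x\<^sub>0"
  have B_ge: "9 / 16 * (unit_ball_vol DIM('a) * (r / 4) ^ DIM('a)) \<le> B"
    using integral_bump_ge[of "r / 2", where 'a='a] r by (simp add: B_def)
  moreover have lower_pos: "0 < 9 / 16 * (unit_ball_vol DIM('a) * (r / 4) ^ DIM('a))"
    using r by simp
  ultimately have B: "0 < B" by linarith
  have "8 / B \<le> 8 / (9 / 16 * (unit_ball_vol DIM('a) * (r / 4) ^ DIM('a)))"
    using B_ge lower_pos B by (intro divide_left_mono mult_pos_pos[OF B]) simp_all
  also have "\<dots> = affine_approx_const DIM('a) / r ^ DIM('a)"
    by (simp add: affine_approx_const_def power_divide)
  finally have const: "8 / B \<le> affine_approx_const DIM('a) / r ^ DIM('a)" .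
  show ?thesis
  proof (rule that[of "(F x\<^sub>0 - g \<bullet> x\<^sub>0) / B" "g /\<^sub>R B"])
    fix x assume x: "norm (x - x\<^sub>0) \<le> r"
    have "f x - ((F x\<^sub>0 - g \<bullet> x\<^sub>0) / B + (g /\<^sub>R B) \<bullet> x) = 1 / B * (f x * B - (F x\<^sub>0 + g \<bullet> (x - x\<^sub>0)))"
      using B by (simp add: inner_diff_right field_simps)
    hence "ennreal \<bar>f x - ((F x\<^sub>0 - g \<bullet> x\<^sub>0) / B + (g /\<^sub>R B) \<bullet> x)\<bar>
        = ennreal (1 / B) * ennreal \<bar>f x * B - (F x\<^sub>0 + g \<bullet> (x - x\<^sub>0))\<bar>"
      using B by (simp only: abs_mult) (simp add: ennreal_mult[symmetric])
    also have "\<dots> \<le> ennreal (1 / B) * (8 * second_diff_control f 1 r x\<^sub>0 x)"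
      unfolding B_def F_def g_def by (intro mult_left_mono bump_affine_error_le f r x) simp
    also have "\<dots> = ennreal (8 / B) * second_diff_control f 1 r x\<^sub>0 x"
      using B ennreal_mult[of "1 / B" 8] by (simp add: mult.assoc[symmetric])
    also have "\<dots> \<le> ennreal (affine_approx_const DIM('a) / r ^ DIM('a)) * second_diff_control f 1 r x\<^sub>0 x"
      using const by (intro mult_right_mono ennreal_leI) auto
    finally show "ennreal \<bar>f x - ((F x\<^sub>0 - g \<bullet> x\<^sub>0) / B + (g /\<^sub>R B) \<bullet> x)\<bar>
      \<le> ennreal (affine_approx_const DIM('a) / r ^ DIM('a)) * second_diff_control f 1 r x\<^sub>0 x" .
  qed
qed

lemma le_powr_plus_scale:
  fixes a u p :: real
  assumes "0 < a" "0 \<le> u" "1 \<le> p"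
  shows "u \<le> a powr (1 - p) * u powr p + a"
proof (cases "u \<le> a")
  case True
  thus ?thesis by (simp add: add_increasing)
next
  case False
  hence "u = u powr (1 - p) * u powr p"
    using assms by (simp add: powr_add[symmetric])
  also have "\<dots> \<le> a powr (1 - p) * u powr p"
    using False assms by (intro mult_right_mono powr_mono2') auto
  finally show ?thesis using assms by linarith
qed

text \<open>A form of Jensen's inequality: choose \<open>a = u / (2 K m)\<close> in the family of Young inequalities.\<close>

lemma powr_le_of_young_family:
  fixes u K m p :: real and P :: ennreal
  assumes family: "\<And>a. 0 < a \<Longrightarrow> ennreal u \<le> ennreal K * (ennreal (a powr (1 - p)) * P + ennreal (a * m))"
    and "0 \<le> u" "0 < K" "0 < m" "1 \<le> p"
  shows "ennreal (u powr p) \<le> ennreal ((2 * K) powr p * m powr (p - 1)) * P"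
proof (cases "u = 0")
  case False
  hence u: "0 < u" using \<open>0 \<le> u\<close> by simp
  define a where "a = u / (2 * K * m)"
  have a: "0 < a" "K * (a * m) = u / 2"
    using u assms by (simp_all add: a_def)
  have "ennreal K * ennreal (a * m) = ennreal (u / 2)"
    using a assms by (simp add: ennreal_mult[symmetric])
  hence "ennreal u \<le> ennreal K * ennreal (a powr (1 - p)) * P + ennreal (u / 2)"
    using family[OF a(1)] by (simp add: distrib_left mult.assoc)
  moreover have "ennreal (u / 2) + ennreal (u / 2) = ennreal u"
    using u by (subst ennreal_plus[symmetric]) auto
  ultimately have "ennreal (u / 2) + ennreal (u / 2)
      \<le> ennreal (u / 2) + ennreal K * ennreal (a powr (1 - p)) * P"
    by (simp add: add.commute)
  hence "ennreal (u / 2) \<le> ennreal K * ennreal (a powr (1 - p)) * P"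
    by (simp add: ennreal_add_left_cancel_le)
  hence "ennreal (2 * u powr (p - 1)) * ennreal (u / 2)
      \<le> ennreal (2 * u powr (p - 1)) * (ennreal K * ennreal (a powr (1 - p)) * P)"
    by (rule mult_left_mono) simp
  also have "\<dots> = ennreal (2 * u powr (p - 1) * K * a powr (1 - p)) * P"
    using assms by (simp add: ennreal_mult mult.assoc)
  also have "2 * u powr (p - 1) * K * a powr (1 - p) = (2 * K) powr p * m powr (p - 1)"
  proof -
    have "a powr (1 - p) = (2 * K) powr (p - 1) * m powr (p - 1) / u powr (p - 1)"
      using powr_minus[of a "p - 1"] u assms by (simp add: a_def powr_divide powr_mult)
    moreover have "2 * K * (2 * K) powr (p - 1) = (2 * K) powr p"
      using assms by (subst powr_mult_base) auto
    ultimately show ?thesis using u by simp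
  qed
  also have "ennreal (2 * u powr (p - 1)) * ennreal (u / 2) = ennreal (u powr p)"
    using u by (simp add: ennreal_mult[symmetric] powr_diff)
  finally show ?thesis .
qed (use assms in simp)

lemma second_diff_mean_1_le:
  fixes f :: "'a::euclidean_space \<Rightarrow> real"
  assumes [measurable]: "f \<in> borel_measurable borel" and "0 < a" "1 \<le> p" "0 \<le> r"
  shows "second_diff_mean f 1 r x \<le> ennreal (a powr (1 - p)) * second_diff_mean f p r x
    + ennreal (a * (unit_ball_vol DIM('a) * r ^ DIM('a)))"
proof -
  have "second_diff_mean f 1 r x
      \<le> (\<integral>\<^sup>+w. ennreal (a powr (1 - p)) * (ennreal (\<bar>second_diff f w x\<bar> powr p) * indicator (ball 0 r) w)
      + ennreal a * indicator (ball 0 r) w \<partial>lborel)"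
    unfolding second_diff_mean_def
  proof (rule nn_integral_mono)
    fix w :: 'a
    have "ennreal (\<bar>second_diff f w x\<bar> powr 1) \<le> ennreal (a powr (1 - p) * \<bar>second_diff f w x\<bar> powr p + a)"
      using le_powr_plus_scale[of a "\<bar>second_diff f w x\<bar>" p] assms by (intro ennreal_leI) auto
    also have "\<dots> = ennreal (a powr (1 - p)) * ennreal (\<bar>second_diff f w x\<bar> powr p) + ennreal a"
      using assms by (simp add: ennreal_mult)
    finally show "ennreal (\<bar>second_diff f w x\<bar> powr 1) * indicator (ball 0 r) w
      \<le> ennreal (a powr (1 - p)) * (ennreal (\<bar>second_diff f w x\<bar> powr p) * indicator (ball 0 r) w)
        + ennreal a * indicator (ball 0 r) w"
      by (simp add: indicator_def)
  qed
  also have "\<dots> = ennreal (a powr (1 - p)) * second_diff_mean f p r x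
      + ennreal a * emeasure lborel (ball (0::'a) r)"
    unfolding second_diff_mean_def
    by (subst nn_integral_add, measurable, subst nn_integral_cmult, measurable,
      subst nn_integral_cmult_indicator) auto
  finally show ?thesis using assms by (simp add: emeasure_ball ennreal_mult)
qed

lemma second_diff_control_1_le:
  fixes f :: "'a::euclidean_space \<Rightarrow> real"
  assumes f [measurable]: "f \<in> borel_measurable borel" and "0 < a" "1 \<le> p" "0 \<le> r"
  shows "second_diff_control f 1 r x\<^sub>0 x \<le> ennreal (a powr (1 - p)) * second_diff_control f p r x\<^sub>0 x
    + ennreal (a * (2 * (unit_ball_vol DIM('a) * r ^ DIM('a))))"
proof -
  let ?c = "ennreal (a powr (1 - p))" and ?e = "ennreal (a * (unit_ball_vol DIM('a) * r ^ DIM('a)))"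
  let ?D = "\<lambda>q t. second_diff_mean f q r (x\<^sub>0 + (t / 2) *\<^sub>R (x - x\<^sub>0))"
  have mean: "second_diff_mean f 1 r z \<le> ?c * second_diff_mean f p r z + ?e" for z
    using assms by (rule second_diff_mean_1_le)
  have "(\<integral>\<^sup>+t\<in>{0..1}. ?D 1 t \<partial>lborel)
      \<le> (\<integral>\<^sup>+t. ?c * (?D p t * indicator {0..1} t) + ?e * indicator {0..1} t \<partial>lborel)"
    using mean by (intro nn_integral_mono) (simp add: indicator_def)
  also have "\<dots> = ?c * (\<integral>\<^sup>+t\<in>{0..1}. ?D p t \<partial>lborel) + ?e"
    by (subst nn_integral_add, measurable, subst nn_integral_cmult, measurable,
      subst nn_integral_cmult_indicator) auto
  finally have "second_diff_control f 1 r x\<^sub>0 x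
      \<le> (?c * second_diff_mean f p r x + ?e) + (?c * (\<integral>\<^sup>+t\<in>{0..1}. ?D p t \<partial>lborel) + ?e)"
    unfolding second_diff_control_def by (rule add_mono[OF mean])
  also have "\<dots> = ?c * second_diff_control f p r x\<^sub>0 x + (?e + ?e)"
    by (simp add: second_diff_control_def distrib_left add_ac)
  also have "?e + ?e = ennreal (a * (2 * (unit_ball_vol DIM('a) * r ^ DIM('a))))"
    using assms by (subst ennreal_plus[symmetric]) auto
  finally show ?thesis .
qed

definition affine_approx_powr_const :: "nat \<Rightarrow> real \<Rightarrow> real" where
  "affine_approx_powr_const n p = (2 * affine_approx_const n) powr p * (2 * unit_ball_vol n) powr (p - 1)"

lemma affine_approx_powr_const_nonneg: "0 \<le> affine_approx_powr_const n p"
  by (simp add: affine_approx_powr_const_def)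

lemma affine_approximation_powr:
  fixes f :: "'a::euclidean_space \<Rightarrow> real"
  assumes f: "locally_integrable f" and r: "0 < r" and p: "1 \<le> p"
  obtains a c where "\<And>x. norm (x - x\<^sub>0) \<le> r \<Longrightarrow> ennreal (\<bar>f x - (a + c \<bullet> x)\<bar> powr p)
    \<le> ennreal (affine_approx_powr_const DIM('a) p / r ^ DIM('a)) * second_diff_control f p r x\<^sub>0 x"
proof -
  let ?K = "affine_approx_const DIM('a)" and ?v = "unit_ball_vol DIM('a)"
  have K: "0 < ?K" by (simp add: affine_approx_const_def)
  obtain a c where affine: "\<And>x. norm (x - x\<^sub>0) \<le> r \<Longrightarrow>
      ennreal \<bar>f x - (a + c \<bullet> x)\<bar> \<le> ennreal (?K / r ^ DIM('a)) * second_diff_control f 1 r x\<^sub>0 x"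
    using affine_approximation[OF f r] by blast
  have const: "(2 * (?K / r ^ DIM('a))) powr p * (2 * (?v * r ^ DIM('a))) powr (p - 1)
      = affine_approx_powr_const DIM('a) p / r ^ DIM('a)"
    using r by (simp add: affine_approx_powr_const_def powr_mult powr_divide powr_diff)
  show ?thesis
  proof (rule that[of a c])
    fix x assume x: "norm (x - x\<^sub>0) \<le> r"
    show "ennreal (\<bar>f x - (a + c \<bullet> x)\<bar> powr p)
        \<le> ennreal (affine_approx_powr_const DIM('a) p / r ^ DIM('a)) * second_diff_control f p r x\<^sub>0 x"
      unfolding const[symmetric]
    proof (rule powr_le_of_young_family)
      fix b :: real assume "0 < b"
      thus "ennreal \<bar>f x - (a + c \<bullet> x)\<bar> \<le> ennreal (?K / r ^ DIM('a))
          * (ennreal (b powr (1 - p)) * second_diff_control f p r x\<^sub>0 x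
            + ennreal (b * (2 * (?v * r ^ DIM('a)))))"
        using locally_integrable_measurable[OF f] r p
        by (intro order_trans[OF affine[OF x]] mult_left_mono second_diff_control_1_le) auto
    qed (use K r p in auto)
  qed
qed

lemma graph_hull_volume_powr_le_sum:
  fixes g :: "'a::euclidean_space \<Rightarrow> real" and X :: "'i \<Rightarrow> 'a"
  assumes I: "finite I" and r: "0 \<le> r" and p: "0 < p" and X: "\<And>i. i \<in> I \<Longrightarrow> norm (X i - x\<^sub>0) \<le> r"
  shows "graph_hull_volume g (X ` I) powr p
    \<le> (2 * unit_ball_vol DIM('a) * r ^ DIM('a)) powr p * (\<Sum>i\<in>I. \<bar>g (X i)\<bar> powr p)"
proof -
  define M where "M = (\<Sum>i\<in>I. \<bar>g (X i)\<bar> powr p) powr (1 / p)"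
  have M: "0 \<le> M" "M powr p = (\<Sum>i\<in>I. \<bar>g (X i)\<bar> powr p)"
    using p by (simp_all add: M_def powr_powr sum_nonneg)
  have "\<bar>g (X i)\<bar> \<le> M" if "i \<in> I" for i
  proof -
    have "\<bar>g (X i)\<bar> powr p \<le> M powr p"
      unfolding M(2) using I that by (intro member_le_sum) auto
    thus ?thesis
      using powr_less_mono2[of p M "\<bar>g (X i)\<bar>"] p M(1) by linarith
  qed
  hence "graph_hull_volume g (X ` I) \<le> 2 * M * (unit_ball_vol DIM('a) * r ^ DIM('a))"
    using I X M(1) r by (intro graph_hull_volume_le[where ?x0.0=x\<^sub>0]) (auto simp: dist_norm norm_minus_commute)
  hence "graph_hull_volume g (X ` I) powr p \<le> (2 * M * (unit_ball_vol DIM('a) * r ^ DIM('a))) powr p"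
    using p by (intro powr_mono2) simp_all
  also have "\<dots> = (2 * unit_ball_vol DIM('a) * r ^ DIM('a)) powr p * M powr p"
    using M(1) r by (simp add: powr_mult mult_ac)
  finally show ?thesis
    unfolding M(2) .
qed

lemma graph_hull_volume_powr_le:
  fixes f :: "'a::euclidean_space \<Rightarrow> real" and X :: "'i \<Rightarrow> 'a"
  assumes f: "locally_integrable f" and r: "0 < r" and p: "1 \<le> p"
    and I: "finite I" and X: "\<And>i. i \<in> I \<Longrightarrow> norm (X i - x\<^sub>0) \<le> r"
  shows "ennreal (graph_hull_volume f (X ` I) powr p)
    \<le> ennreal ((2 * unit_ball_vol DIM('a)) powr p * affine_approx_powr_const DIM('a) p
      * r powr (real DIM('a) * (p - 1)))
      * (\<Sum>i\<in>I. second_diff_control f p r x\<^sub>0 (X i))"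
proof -
  let ?v = "unit_ball_vol DIM('a)" and ?K = "affine_approx_powr_const DIM('a) p"
  obtain a c where affine: "\<And>x. norm (x - x\<^sub>0) \<le> r \<Longrightarrow> ennreal (\<bar>f x - (a + c \<bullet> x)\<bar> powr p)
     \<le> ennreal (?K / r ^ DIM('a)) * second_diff_control f p r x\<^sub>0 x"
    using affine_approximation_powr[OF f r p] by blast
  define g where "g x = f x - (a + c \<bullet> x)" for x
  have "graph_hull_volume f (X ` I) = graph_hull_volume g (X ` I)"
    using I by (simp add: g_def[abs_def] graph_hull_volume_diff_affine)
  hence "ennreal (graph_hull_volume f (X ` I) powr p)
      \<le> ennreal ((2 * ?v * r ^ DIM('a)) powr p * (\<Sum>i\<in>I. \<bar>g (X i)\<bar> powr p))"
    using graph_hull_volume_powr_le_sum[of I r p X x\<^sub>0 g] I r p X by (simp add: ennreal_leI)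
  also have "\<dots> = ennreal ((2 * ?v * r ^ DIM('a)) powr p) * (\<Sum>i\<in>I. ennreal (\<bar>g (X i)\<bar> powr p))"
    by (simp add: ennreal_mult sum_nonneg)
  also have "\<dots> \<le> ennreal ((2 * ?v * r ^ DIM('a)) powr p)
      * (\<Sum>i\<in>I. ennreal (?K / r ^ DIM('a)) * second_diff_control f p r x\<^sub>0 (X i))"
    using X by (intro mult_left_mono sum_mono) (simp_all add: g_def affine)
  also have "\<dots> = ennreal ((2 * ?v * r ^ DIM('a)) powr p * (?K / r ^ DIM('a)))
      * (\<Sum>i\<in>I. second_diff_control f p r x\<^sub>0 (X i))"
    using r by (subst ennreal_mult) (simp_all add: affine_approx_powr_const_nonneg sum_distrib_left mult.assoc)
  also have "(2 * ?v * r ^ DIM('a)) powr p * (?K / r ^ DIM('a))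
      = (2 * ?v) powr p * ?K * r powr (real DIM('a) * (p - 1))"
    using r by (simp add: powr_mult powr_realpow[symmetric] powr_powr right_diff_distrib powr_diff)
  finally show ?thesis .
qed

subsection \<open>The upper bound for Borel functions\<close>

definition simplex_density :: "real \<Rightarrow> real \<Rightarrow> ('a::euclidean_space \<Rightarrow> real) \<Rightarrow> 'a set \<Rightarrow> ennreal" where
  "simplex_density p \<beta> f A = ennreal (graph_hull_volume f A powr p / diameter A powr \<beta>)"

definition simplex_energy :: "real \<Rightarrow> real \<Rightarrow> nat \<Rightarrow> ('a::euclidean_space \<Rightarrow> real) \<Rightarrow> ennreal" where
  "simplex_energy p \<beta> m f =
    (\<integral>\<^sup>+X. simplex_density p \<beta> f (X ` {..m}) \<partial>PiM {..m} (\<lambda>_. lborel))"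

definition second_diff_energy :: "real \<Rightarrow> real \<Rightarrow> ('a::euclidean_space \<Rightarrow> real) \<Rightarrow> ennreal" where
  "second_diff_energy p \<gamma> f =
    (\<integral>\<^sup>+x. (\<integral>\<^sup>+h. ennreal (\<bar>second_diff f h x\<bar> powr p / norm h powr \<gamma>) \<partial>lborel) \<partial>lborel)"

lemma product_sigma_finite_lborel:
  "product_sigma_finite (\<lambda>_::'i. lborel :: 'a::euclidean_space measure)"
  by standard

lemma measurable_component_lborel:
  assumes "i \<in> I"
  shows "(\<lambda>X. X i) \<in> borel_measurable (PiM I (\<lambda>_. lborel :: 'a::euclidean_space measure))"
  using measurable_component_singleton[OF assms, of "\<lambda>_. lborel :: 'a measure"] by simp

lemma borel_measurable_prod_ball:
  assumes "\<And>j. j \<in> J \<Longrightarrow> (\<lambda>z. X z j) \<in> borel_measurable M" "c \<in> borel_measurable M" "r \<in> borel_measurable M"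
  shows "(\<lambda>z. \<Prod>j\<in>J. indicator (ball (c z) (r z)) (X z j :: 'a::euclidean_space) :: ennreal)
    \<in> borel_measurable M"
proof (rule borel_measurable_prod_ennreal)
  fix j assume "j \<in> J"
  note [measurable] = assms(1)[OF this] assms(2,3)
  show "(\<lambda>z. indicator (ball (c z) (r z)) (X z j) :: ennreal) \<in> borel_measurable M"
    unfolding indicator_ball_eq by measurable
qed

lemma nn_integral_prod_ball:
  fixes a :: "'i \<Rightarrow> 'a::euclidean_space"
  assumes "finite J" "0 \<le> r"
  shows "(\<integral>\<^sup>+Y. (\<Prod>j\<in>J. indicator (ball (a j) r) (Y j)) \<partial>PiM J (\<lambda>_. lborel))
    = ennreal (unit_ball_vol DIM('a) * r ^ DIM('a)) ^ card J"
proof -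
  interpret product_sigma_finite "\<lambda>_. lborel :: 'a measure" by (rule product_sigma_finite_lborel)
  show ?thesis
    using assms by (subst product_nn_integral_prod) (auto simp: emeasure_ball)
qed

lemma nn_integral_prod_ball_mult:
  fixes x :: "'a::euclidean_space" and H :: "'a \<Rightarrow> ennreal"
  assumes J: "finite J" "i \<in> J" and r: "0 \<le> r" and [measurable]: "H \<in> borel_measurable borel"
  shows "(\<integral>\<^sup>+Y. (\<Prod>j\<in>J. indicator (ball x r) (Y j)) * H (Y i) \<partial>PiM J (\<lambda>_. lborel))
    = ennreal (unit_ball_vol DIM('a) * r ^ DIM('a)) ^ (card J - 1) * (\<integral>\<^sup>+u\<in>ball 0 r. H (x + u) \<partial>lborel)"
proof -
  interpret product_sigma_finite "\<lambda>_. lborel :: 'a measure" by (rule product_sigma_finite_lborel)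
  let ?factor = "\<lambda>j y. indicator (ball x r) y * (if j = i then H y else 1)"
  have "(\<integral>\<^sup>+Y. (\<Prod>j\<in>J. indicator (ball x r) (Y j)) * H (Y i) \<partial>PiM J (\<lambda>_. lborel))
      = (\<integral>\<^sup>+Y. (\<Prod>j\<in>J. ?factor j (Y j)) \<partial>PiM J (\<lambda>_. lborel))"
    using J by (simp add: prod.distrib)
  also have "\<dots> = (\<Prod>j\<in>J. \<integral>\<^sup>+y. ?factor j y \<partial>lborel)"
    using J by (intro product_nn_integral_prod) auto
  also have "\<dots> = (\<integral>\<^sup>+y. ?factor i y \<partial>lborel) * (\<Prod>j\<in>J - {i}. emeasure lborel (ball x r))"
    using J by (subst prod.remove[of J i]) (auto intro!: arg_cong2[where f="(*)"] prod.cong)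
  also have "(\<Prod>j\<in>J - {i}. emeasure lborel (ball x r))
      = ennreal (unit_ball_vol DIM('a) * r ^ DIM('a)) ^ (card J - 1)"
    using J r by (simp add: emeasure_ball)
  also have "(\<integral>\<^sup>+y. ?factor i y \<partial>lborel) = (\<integral>\<^sup>+u. indicator (ball x r) (x + u) * H (x + u) \<partial>lborel)"
    by (subst nn_integral_lborel_translate[where g="\<lambda>y. indicator (ball x r) y * H y"]) simp_all
  also have "\<dots> = (\<integral>\<^sup>+u\<in>ball 0 r. H (x + u) \<partial>lborel)"
    by (simp add: indicator_ball_eq dist_norm mult.commute)
  finally show ?thesis by (simp add: mult.commute)
qed

lemma nn_integral_ball_average:
  fixes G :: "'a::euclidean_space \<Rightarrow> ennreal"
  assumes G [measurable]: "G \<in> borel_measurable borel" and r: "0 \<le> r"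
  shows "(\<integral>\<^sup>+x. (\<integral>\<^sup>+u\<in>ball 0 r. G (x + t *\<^sub>R u) \<partial>lborel) \<partial>lborel)
    = ennreal (unit_ball_vol DIM('a) * r ^ DIM('a)) * (\<integral>\<^sup>+x. G x \<partial>lborel)"
proof -
  have translate: "(\<integral>\<^sup>+x. G (x + t *\<^sub>R u) \<partial>lborel) = (\<integral>\<^sup>+x. G x \<partial>lborel)" for u
    using nn_integral_lborel_translate[OF G, of "t *\<^sub>R u"] by (simp add: add.commute)
  have "(\<integral>\<^sup>+x. (\<integral>\<^sup>+u\<in>ball 0 r. G (x + t *\<^sub>R u) \<partial>lborel) \<partial>lborel)
      = (\<integral>\<^sup>+u. (\<integral>\<^sup>+x. G (x + t *\<^sub>R u) * indicator (ball 0 r) u \<partial>lborel) \<partial>lborel)"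
    by (rule lborel_pair.Fubini'[symmetric]) measurable
  also have "\<dots> = (\<integral>\<^sup>+u. (\<integral>\<^sup>+x. G x \<partial>lborel) * indicator (ball (0::'a) r) u \<partial>lborel)"
    by (simp add: nn_integral_multc translate)
  also have "\<dots> = ennreal (unit_ball_vol DIM('a) * r ^ DIM('a)) * (\<integral>\<^sup>+x. G x \<partial>lborel)"
    using r by (subst nn_integral_cmult_indicator) (simp_all add: emeasure_ball mult.commute)
  finally show ?thesis .
qed

lemma nn_integral_cluster:
  fixes G :: "'a::euclidean_space \<Rightarrow> ennreal"
  assumes G [measurable]: "G \<in> borel_measurable borel" and J: "finite J" "k \<notin> J" "i \<in> insert k J" and r: "0 \<le> r"
  shows "(\<integral>\<^sup>+X. (\<Prod>j\<in>J. indicator (ball (X k) r) (X j)) * G (X k + t *\<^sub>R (X i - X k))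
      \<partial>PiM (insert k J) (\<lambda>_. lborel))
    = ennreal (unit_ball_vol DIM('a) * r ^ DIM('a)) ^ card J * (\<integral>\<^sup>+x. G x \<partial>lborel)"
proof -
  interpret product_sigma_finite "\<lambda>_. lborel :: 'a measure" by (rule product_sigma_finite_lborel)
  let ?v = "ennreal (unit_ball_vol DIM('a) * r ^ DIM('a))"
  note [measurable] = measurable_component_lborel[of k "insert k J"] measurable_component_lborel[OF J(3)]
    borel_measurable_prod_ball[of J "\<lambda>X. X" "PiM (insert k J) (\<lambda>_. lborel)", OF measurable_component_lborel]
  have "(\<integral>\<^sup>+X. (\<Prod>j\<in>J. indicator (ball (X k) r) (X j)) * G (X k + t *\<^sub>R (X i - X k))
      \<partial>PiM (insert k J) (\<lambda>_. lborel))
    = (\<integral>\<^sup>+x. (\<integral>\<^sup>+Y. (\<Prod>j\<in>J. indicator (ball x r) (Y j))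
      * G (x + t *\<^sub>R ((Y(k := x)) i - x)) \<partial>PiM J (\<lambda>_. lborel)) \<partial>lborel)"
    using J by (subst product_nn_integral_insert_rev)
      (auto intro!: nn_integral_cong arg_cong2[where f="(*)"] prod.cong)
  also have "\<dots> = ?v ^ card J * (\<integral>\<^sup>+x. G x \<partial>lborel)"
  proof (cases "i = k")
    case True
    have [measurable]: "(\<lambda>Y. \<Prod>j\<in>J. indicator (ball x r) (Y j) :: ennreal)
        \<in> borel_measurable (PiM J (\<lambda>_. lborel))" for x :: 'a
      by (intro borel_measurable_prod_ball measurable_component_lborel) auto
    show ?thesis
      using True J r by (simp add: nn_integral_multc nn_integral_cmult nn_integral_prod_ball)
  next
    case False
    hence i: "i \<in> J" using J by simp
    have "(\<integral>\<^sup>+x. (\<integral>\<^sup>+Y. (\<Prod>j\<in>J. indicator (ball x r) (Y j))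
        * G (x + t *\<^sub>R ((Y(k := x)) i - x)) \<partial>PiM J (\<lambda>_. lborel)) \<partial>lborel)
        = (\<integral>\<^sup>+x. ?v ^ (card J - 1) * (\<integral>\<^sup>+u\<in>ball 0 r. G (x + t *\<^sub>R u) \<partial>lborel) \<partial>lborel)"
    proof (rule nn_integral_cong)
      fix x :: 'a
      show "(\<integral>\<^sup>+Y. (\<Prod>j\<in>J. indicator (ball x r) (Y j)) * G (x + t *\<^sub>R ((Y(k := x)) i - x)) \<partial>PiM J (\<lambda>_. lborel))
        = ?v ^ (card J - 1) * (\<integral>\<^sup>+u\<in>ball 0 r. G (x + t *\<^sub>R u) \<partial>lborel)"
        using nn_integral_prod_ball_mult[OF J(1) i r, of "\<lambda>y. G (x + t *\<^sub>R (y - x))" x] False by simp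
    qed
    also have "\<dots> = (?v ^ (card J - 1) * ?v) * (\<integral>\<^sup>+x. G x \<partial>lborel)"
      by (subst nn_integral_cmult, measurable) (simp add: nn_integral_ball_average[OF G r] mult.assoc)
    also have "?v ^ (card J - 1) * ?v = ?v ^ card J"
      using J(1) i by (metis card_gt_0_iff empty_iff power_minus_mult)
    finally show ?thesis .
  qed
  finally show ?thesis .
qed

definition cluster :: "nat \<Rightarrow> real \<Rightarrow> (nat \<Rightarrow> 'a::euclidean_space) \<Rightarrow> ennreal" where
  "cluster m r X = (\<Prod>j\<in>{1..m}. indicator (ball (X 0) r) (X j))"

lemma cluster_eq_1:
  assumes "\<And>j. j \<le> m \<Longrightarrow> dist (X 0) (X j) < r"
  shows "cluster m r X = 1"
  unfolding cluster_def using assms by (intro prod.neutral) simp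

lemma cluster_measurable:
  assumes "\<And>j. j \<le> m \<Longrightarrow> (\<lambda>z. X z j) \<in> borel_measurable M" "r \<in> borel_measurable M"
  shows "(\<lambda>z. cluster m (r z) (X z)) \<in> borel_measurable M"
  unfolding cluster_def using assms by (intro borel_measurable_prod_ball) auto

lemma second_diff_control_measurable [measurable]:
  fixes f :: "'a::euclidean_space \<Rightarrow> real"
  assumes [measurable]: "f \<in> borel_measurable borel" "r \<in> borel_measurable M"
    "a \<in> borel_measurable M" "b \<in> borel_measurable M"
  shows "(\<lambda>z. second_diff_control f p (r z) (a z) (b z)) \<in> borel_measurable M"
  unfolding second_diff_control_def by measurable

lemma nn_integral_cluster_second_diff_control:
  fixes f :: "'a::euclidean_space \<Rightarrow> real"
  assumes [measurable]: "f \<in> borel_measurable borel" and i: "i \<le> m" and r: "0 \<le> r"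
  shows "(\<integral>\<^sup>+X. cluster m r X * second_diff_control f p r (X 0) (X i) \<partial>PiM {..m} (\<lambda>_. lborel))
    = 2 * (ennreal (unit_ball_vol DIM('a) * r ^ DIM('a)) ^ m * (\<integral>\<^sup>+x. second_diff_mean f p r x \<partial>lborel))"
proof -
  interpret product_sigma_finite "\<lambda>_. lborel :: 'a measure" by (rule product_sigma_finite_lborel)
  interpret fin: finite_product_sigma_finite "\<lambda>_. lborel :: 'a measure" "{..m}" by standard simp
  interpret P: pair_sigma_finite "PiM {..m} (\<lambda>_. lborel :: 'a measure)" "lborel :: real measure" by standard
  let ?P = "PiM {..m} (\<lambda>_. lborel :: 'a measure)" and ?D = "second_diff_mean f p r"
  let ?V = "ennreal (unit_ball_vol DIM('a) * r ^ DIM('a)) ^ m * (\<integral>\<^sup>+x. ?D x \<partial>lborel)"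
  have [measurable]: "(\<lambda>X. X 0) \<in> borel_measurable ?P" "(\<lambda>X. X i) \<in> borel_measurable ?P"
    using i by (auto intro!: measurable_component_lborel)
  have [measurable]: "cluster m r \<in> borel_measurable ?P"
    using cluster_measurable[of m "\<lambda>X. X" ?P "\<lambda>_. r"] by (simp add: measurable_component_lborel)
  have average: "(\<integral>\<^sup>+X. cluster m r X * ?D (X 0 + t *\<^sub>R (X i - X 0)) \<partial>?P) = ?V" for t
  proof -
    have "{..m} = insert 0 {1..m}" "i \<in> insert 0 {1..m}"
      using i by auto
    thus ?thesis
      using nn_integral_cluster[of ?D "{1..m}" 0 i r t] r by (simp add: cluster_def)
  qed
  have "(\<integral>\<^sup>+X. cluster m r X * (\<integral>\<^sup>+t\<in>{0..1}. ?D (X 0 + (t / 2) *\<^sub>R (X i - X 0)) \<partial>lborel) \<partial>?P)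
      = (\<integral>\<^sup>+X. (\<integral>\<^sup>+t. cluster m r X * ?D (X 0 + (t / 2) *\<^sub>R (X i - X 0)) * indicator {0..1} t \<partial>lborel) \<partial>?P)"
    by (simp add: nn_integral_cmult[symmetric] mult.assoc)
  also have "\<dots> = (\<integral>\<^sup>+t. (\<integral>\<^sup>+X. cluster m r X * ?D (X 0 + (t / 2) *\<^sub>R (X i - X 0))
      * indicator {0..1} t \<partial>?P) \<partial>lborel)"
    by (rule P.Fubini'[symmetric]) measurable
  also have "\<dots> = (\<integral>\<^sup>+t. ?V * indicator {0..1::real} t \<partial>lborel)"
    by (simp add: nn_integral_multc average)
  also have "\<dots> = ?V"
    by (simp add: nn_integral_cmult_indicator)
  finally have path: "(\<integral>\<^sup>+X. cluster m r X
      * (\<integral>\<^sup>+t\<in>{0..1}. ?D (X 0 + (t / 2) *\<^sub>R (X i - X 0)) \<partial>lborel) \<partial>?P) = ?V" .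
  have "(\<integral>\<^sup>+X. cluster m r X * second_diff_control f p r (X 0) (X i) \<partial>?P)
      = (\<integral>\<^sup>+X. cluster m r X * ?D (X i) \<partial>?P)
        + (\<integral>\<^sup>+X. cluster m r X * (\<integral>\<^sup>+t\<in>{0..1}. ?D (X 0 + (t / 2) *\<^sub>R (X i - X 0)) \<partial>lborel) \<partial>?P)"
    unfolding second_diff_control_def distrib_left by (rule nn_integral_add) measurable
  thus ?thesis
    using average[of 1] path by (simp add: mult_2)
qed

definition cluster_control :: "('a::euclidean_space \<Rightarrow> real) \<Rightarrow> real \<Rightarrow> nat \<Rightarrow> real \<Rightarrow> (nat \<Rightarrow> 'a) \<Rightarrow> ennreal" where
  "cluster_control f p m r X = cluster m r X * (\<Sum>i\<le>m. second_diff_control f p r (X 0) (X i))"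

lemma cluster_control_measurable:
  assumes "f \<in> borel_measurable borel" "\<And>i. i \<le> m \<Longrightarrow> (\<lambda>z. X z i) \<in> borel_measurable M" "r \<in> borel_measurable M"
  shows "(\<lambda>z. cluster_control f p m (r z) (X z)) \<in> borel_measurable M"
  unfolding cluster_control_def using assms
  by (intro borel_measurable_times_ennreal borel_measurable_sum cluster_measurable
    second_diff_control_measurable) auto

lemma nn_integral_cluster_control:
  fixes f :: "'a::euclidean_space \<Rightarrow> real"
  assumes f: "f \<in> borel_measurable borel" and r: "0 \<le> r"
  shows "(\<integral>\<^sup>+X. cluster_control f p m r X \<partial>PiM {..m} (\<lambda>_. lborel))
    = of_nat (m + 1) * (2 * (ennreal (unit_ball_vol DIM('a) * r ^ DIM('a)) ^ m
      * (\<integral>\<^sup>+x. second_diff_mean f p r x \<partial>lborel)))"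
proof -
  have "(\<integral>\<^sup>+X. cluster_control f p m r X \<partial>PiM {..m} (\<lambda>_. lborel))
      = (\<Sum>i\<le>m. \<integral>\<^sup>+X. cluster m r X * second_diff_control f p r (X 0) (X i) \<partial>PiM {..m} (\<lambda>_. lborel))"
    unfolding cluster_control_def sum_distrib_left
    by (intro nn_integral_sum borel_measurable_times_ennreal cluster_measurable
        second_diff_control_measurable measurable_component_lborel f) simp_all
  thus ?thesis
    using nn_integral_cluster_second_diff_control[OF f _ r] by simp
qed

lemma nn_integral_powr_tail:
  fixes a b :: real
  assumes "0 < a" "0 < b"
  shows "(\<integral>\<^sup>+r\<in>{a<..}. ennreal (b * r powr (- b - 1)) \<partial>lborel) = ennreal (a powr (- b))"
proof -
  have "(\<integral>\<^sup>+r\<in>{a<..}. ennreal (b * r powr (- b - 1)) \<partial>lborel)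
      = (\<integral>\<^sup>+r\<in>{a..}. ennreal (b * r powr (- b - 1)) \<partial>lborel)"
    by (rule nn_integral_cong_AE, rule AE_mp[OF AE_lborel_singleton[of a]]) (auto simp: indicator_def)
  also have "\<dots> = ennreal (0 - (- (a powr (- b))))"
  proof (rule nn_integral_FTC_atLeast)
    show "((\<lambda>r. - (r powr (- b))) has_real_derivative b * x powr (- b - 1)) (at x)" if "a \<le> x" for x
      using that assms by (auto intro!: derivative_eq_intros)
    show "((\<lambda>r. - (r powr (- b))) \<longlongrightarrow> 0) at_top"
      using tendsto_minus[OF tendsto_neg_powr[of "-b" "\<lambda>x. x"]] assms by (simp add: filterlim_ident)
  qed (use assms in auto)
  finally show ?thesis by simp
qed

lemma second_diff_energy_radial:
  fixes f :: "'a::euclidean_space \<Rightarrow> real"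
  assumes [measurable]: "f \<in> borel_measurable borel" and \<gamma>: "0 < \<gamma>"
  shows "(\<integral>\<^sup>+r\<in>{0<..}. ennreal (\<gamma> * r powr (- \<gamma> - 1)) * (\<integral>\<^sup>+x. second_diff_mean f p r x \<partial>lborel) \<partial>lborel)
    = second_diff_energy p \<gamma> f"
proof -
  let ?s = "\<lambda>x w. ennreal (\<bar>second_diff f w x\<bar> powr p)"
  let ?\<kappa> = "\<lambda>r. ennreal (\<gamma> * r powr (- \<gamma> - 1))"
  let ?F = "\<lambda>x w r. ?\<kappa> r * indicator {0<..} r * (?s x w * indicator (ball 0 r) w)"
  have [measurable]: "(\<lambda>z. indicator (ball 0 (r z)) (w z) :: ennreal) \<in> borel_measurable M"
    if [measurable]: "r \<in> borel_measurable M" "w \<in> borel_measurable M"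
    for r and w :: "_ \<Rightarrow> 'a" and M :: "'m measure"
    unfolding indicator_ball_eq by measurable
  have "(\<integral>\<^sup>+r\<in>{0<..}. ?\<kappa> r * (\<integral>\<^sup>+x. second_diff_mean f p r x \<partial>lborel) \<partial>lborel)
      = (\<integral>\<^sup>+r. (\<integral>\<^sup>+x. (\<integral>\<^sup>+w. ?F x w r \<partial>lborel) \<partial>lborel) \<partial>lborel)"
    by (simp add: second_diff_mean_def nn_integral_cmult) (simp only: mult_ac)
  also have "\<dots> = (\<integral>\<^sup>+x. (\<integral>\<^sup>+r. (\<integral>\<^sup>+w. ?F x w r \<partial>lborel) \<partial>lborel) \<partial>lborel)"
    unfolding indicator_ball_eq by (rule lborel_pair.Fubini') measurable
  also have "\<dots> = (\<integral>\<^sup>+x. (\<integral>\<^sup>+w. (\<integral>\<^sup>+r. ?F x w r \<partial>lborel) \<partial>lborel) \<partial>lborel)"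
    unfolding indicator_ball_eq by (rule nn_integral_cong, rule lborel_pair.Fubini') measurable
  also have "\<dots> = second_diff_energy p \<gamma> f"
    unfolding second_diff_energy_def
  proof (intro nn_integral_cong)
    fix x w :: 'a
    show "(\<integral>\<^sup>+r. ?F x w r \<partial>lborel) = ennreal (\<bar>second_diff f w x\<bar> powr p / norm w powr \<gamma>)"
    proof (cases "w = 0")
      case False
      have "(\<integral>\<^sup>+r. ?F x w r \<partial>lborel) = (\<integral>\<^sup>+r. ?s x w * (?\<kappa> r * indicator {norm w<..} r) \<partial>lborel)"
        using less_le_trans[OF le_less_trans[OF norm_ge_zero[of w]]]
        by (intro nn_integral_cong) (auto simp: indicator_def mult_ac)
      also have "\<dots> = ?s x w * ennreal (norm w powr (- \<gamma>))"
        using False \<gamma> by (subst nn_integral_cmult) (auto simp: nn_integral_powr_tail)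
      also have "\<dots> = ennreal (\<bar>second_diff f w x\<bar> powr p / norm w powr \<gamma>)"
        by (simp add: ennreal_mult[symmetric] powr_minus divide_inverse)
      finally show ?thesis .
    qed simp
  qed
  finally show ?thesis .
qed

definition graph_volume_const :: "nat \<Rightarrow> real \<Rightarrow> real" where
  "graph_volume_const n p = (2 * unit_ball_vol n) powr p * affine_approx_powr_const n p"

lemma graph_volume_const_nonneg: "0 \<le> graph_volume_const n p"
  by (simp add: graph_volume_const_def affine_approx_powr_const_nonneg)

definition radial_weight :: "nat \<Rightarrow> real \<Rightarrow> real \<Rightarrow> real \<Rightarrow> real" where
  "radial_weight n p \<beta> r = \<beta> * graph_volume_const n p * r powr (real n * (p - 1) - \<beta> - 1)"

lemma radial_weight_nonneg: "0 \<le> \<beta> \<Longrightarrow> 0 \<le> radial_weight n p \<beta> r"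
  by (simp add: radial_weight_def graph_volume_const_nonneg)

lemma radial_weight_measurable [measurable]: "radial_weight n p \<beta> \<in> borel_measurable borel"
  unfolding radial_weight_def[abs_def] by measurable

lemma graph_hull_volume_layer_le:
  fixes f :: "'a::euclidean_space \<Rightarrow> real" and X :: "nat \<Rightarrow> 'a"
  assumes f: "locally_integrable f" and p: "1 \<le> p" and \<beta>: "0 \<le> \<beta>" and r: "0 < r"
    and near: "\<And>i. i \<le> m \<Longrightarrow> dist (X 0) (X i) < r"
  shows "ennreal (\<beta> * r powr (- \<beta> - 1)) * ennreal (graph_hull_volume f (X ` {..m}) powr p)
    \<le> ennreal (radial_weight DIM('a) p \<beta> r) * cluster_control f p m r X"
proof -
  let ?K = "graph_volume_const DIM('a) p" and ?n = "real DIM('a)"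
  let ?T = "\<Sum>i\<le>m. second_diff_control f p r (X 0) (X i)"
  have "ennreal (graph_hull_volume f (X ` {..m}) powr p) \<le> ennreal (?K * r powr (?n * (p - 1))) * ?T"
    using graph_hull_volume_powr_le[OF f r p, of "{..m}" X "X 0"] near
    by (simp add: graph_volume_const_def dist_norm norm_minus_commute less_imp_le)
  hence "ennreal (\<beta> * r powr (- \<beta> - 1)) * ennreal (graph_hull_volume f (X ` {..m}) powr p)
      \<le> ennreal (\<beta> * r powr (- \<beta> - 1)) * (ennreal (?K * r powr (?n * (p - 1))) * ?T)"
    by (rule mult_left_mono) simp
  also have "\<dots> = ennreal (\<beta> * r powr (- \<beta> - 1) * (?K * r powr (?n * (p - 1)))) * ?T"
    using \<beta> graph_volume_const_nonneg by (subst ennreal_mult) (simp_all add: mult.assoc)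
  also have "\<beta> * r powr (- \<beta> - 1) * (?K * r powr (?n * (p - 1))) = radial_weight DIM('a) p \<beta> r"
  proof -
    have "?n * (p - 1) - \<beta> - 1 = (- \<beta> - 1) + ?n * (p - 1)" by simp
    thus ?thesis by (simp only: radial_weight_def powr_add mult_ac)
  qed
  finally show ?thesis
    using cluster_eq_1[of m X r] near by (simp add: cluster_control_def)
qed

lemma simplex_density_le:
  fixes f :: "'a::euclidean_space \<Rightarrow> real" and X :: "nat \<Rightarrow> 'a"
  assumes f: "locally_integrable f" and p: "1 \<le> p" and \<beta>: "0 < \<beta>"
  shows "simplex_density p \<beta> f (X ` {..m})
    \<le> (\<integral>\<^sup>+r\<in>{0<..}. ennreal (radial_weight DIM('a) p \<beta> r) * cluster_control f p m r X \<partial>lborel)"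
proof (cases "diameter (X ` {..m}) = 0")
  case False
  let ?V = "graph_hull_volume f (X ` {..m}) powr p" and ?d = "diameter (X ` {..m})"
  have d: "0 < ?d"
    using False diameter_ge_0[of "X ` {..m}"] by (simp add: finite_imp_bounded)
  have "simplex_density p \<beta> f (X ` {..m}) = ennreal (?d powr (- \<beta>)) * ennreal ?V"
    using d by (simp add: simplex_density_def powr_minus divide_inverse ennreal_mult[symmetric] mult.commute)
  also have "\<dots> = (\<integral>\<^sup>+r. ennreal (\<beta> * r powr (- \<beta> - 1)) * indicator {?d<..} r * ennreal ?V \<partial>lborel)"
    by (simp add: nn_integral_multc nn_integral_powr_tail[OF d \<beta>])
  also have "\<dots> \<le> (\<integral>\<^sup>+r\<in>{0<..}. ennreal (radial_weight DIM('a) p \<beta> r) * cluster_control f p m r X \<partial>lborel)"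
  proof (rule nn_integral_mono)
    fix r :: real
    show "ennreal (\<beta> * r powr (- \<beta> - 1)) * indicator {?d<..} r * ennreal ?V
      \<le> ennreal (radial_weight DIM('a) p \<beta> r) * cluster_control f p m r X * indicator {0<..} r"
    proof (cases "?d < r")
      case True
      have "dist (X 0) (X i) < r" if "i \<le> m" for i
        using diameter_bounded_bound[of "X ` {..m}" "X 0" "X i"] that True by (simp add: finite_imp_bounded)
      thus ?thesis
        using graph_hull_volume_layer_le[OF f p, of \<beta> r m X] \<beta> d True by simp
    qed simp
  qed
  finally show ?thesis .
qed (simp add: simplex_density_def)

lemma simplex_energy_le_radial:
  fixes f :: "'a::euclidean_space \<Rightarrow> real"
  assumes f: "locally_integrable f" and p: "1 \<le> p" and \<beta>: "0 < \<beta>"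
  shows "simplex_energy p \<beta> m f \<le> (\<integral>\<^sup>+r\<in>{0<..}. ennreal (radial_weight DIM('a) p \<beta> r)
      * (of_nat (m + 1) * (2 * (ennreal (unit_ball_vol DIM('a) * r ^ DIM('a)) ^ m
        * (\<integral>\<^sup>+x. second_diff_mean f p r x \<partial>lborel)))) \<partial>lborel)"
proof -
  note f_borel = locally_integrable_measurable[OF f]
  interpret product_sigma_finite "\<lambda>_. lborel :: 'a measure" by (rule product_sigma_finite_lborel)
  interpret fin: finite_product_sigma_finite "\<lambda>_. lborel :: 'a measure" "{..m}" by standard simp
  interpret P: pair_sigma_finite "PiM {..m} (\<lambda>_. lborel :: 'a measure)" "lborel :: real measure" by standard
  let ?P = "PiM {..m} (\<lambda>_. lborel :: 'a measure)" and ?\<kappa> = "\<lambda>r. ennreal (radial_weight DIM('a) p \<beta> r)"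
  have [measurable]: "(\<lambda>z. cluster_control f p m (snd z) (fst z)) \<in> borel_measurable (?P \<Otimes>\<^sub>M lborel)"
    by (intro cluster_control_measurable f_borel
      measurable_compose[OF measurable_fst measurable_component_lborel])
      simp_all
  have [measurable]: "(\<lambda>X. cluster_control f p m r X) \<in> borel_measurable ?P" for r
    by (intro cluster_control_measurable f_borel measurable_component_lborel) simp_all
  have "simplex_energy p \<beta> m f \<le> (\<integral>\<^sup>+X. (\<integral>\<^sup>+r\<in>{0<..}. ?\<kappa> r * cluster_control f p m r X \<partial>lborel) \<partial>?P)"
    unfolding simplex_energy_def by (intro nn_integral_mono simplex_density_le f p \<beta>)
  also have "\<dots> = (\<integral>\<^sup>+r. (\<integral>\<^sup>+X. ?\<kappa> r * cluster_control f p m r X * indicator {0<..} r \<partial>?P) \<partial>lborel)"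
    by (rule P.Fubini'[symmetric]) (simp add: split_beta')
  also have "\<dots> = (\<integral>\<^sup>+r\<in>{0<..}. ?\<kappa> r * (of_nat (m + 1) * (2 * (ennreal (unit_ball_vol DIM('a) * r ^ DIM('a)) ^ m
      * (\<integral>\<^sup>+x. second_diff_mean f p r x \<partial>lborel)))) \<partial>lborel)"
    using nn_integral_cluster_control[OF f_borel, of _ m p]
    by (intro nn_integral_cong) (simp add: nn_integral_cmult nn_integral_multc indicator_def)
  finally show ?thesis .
qed

text \<open>The exponent for which both energies scale alike under dilations of the domain.\<close>

definition energy_exponent :: "nat \<Rightarrow> nat \<Rightarrow> real \<Rightarrow> real \<Rightarrow> real" where
  "energy_exponent n m p \<gamma> = \<gamma> + real n * (p - 1) + real n * real m"

lemma energy_exponent_pos: "1 \<le> p \<Longrightarrow> 0 < \<gamma> \<Longrightarrow> 0 < energy_exponent n m p \<gamma>"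
  by (simp add: energy_exponent_def add_pos_nonneg)

definition energy_upper_const :: "nat \<Rightarrow> nat \<Rightarrow> real \<Rightarrow> real \<Rightarrow> real" where
  "energy_upper_const n m p \<gamma> =
    energy_exponent n m p \<gamma> * graph_volume_const n p * (2 * real (m + 1)) * unit_ball_vol n ^ m / \<gamma>"

lemma energy_upper_const_nonneg: "1 \<le> p \<Longrightarrow> 0 < \<gamma> \<Longrightarrow> 0 \<le> energy_upper_const n m p \<gamma>"
  using energy_exponent_pos[of p \<gamma> n m] by (simp add: energy_upper_const_def graph_volume_const_nonneg)

lemma radial_weight_mult_eq:
  assumes p: "1 \<le> p" and \<gamma>: "0 < \<gamma>" and r: "0 < r"
  shows "ennreal (radial_weight n p (energy_exponent n m p \<gamma>) r)
      * (of_nat (m + 1) * (2 * ennreal (unit_ball_vol n * r ^ n) ^ m))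
    = ennreal (energy_upper_const n m p \<gamma>) * ennreal (\<gamma> * r powr (- \<gamma> - 1))"
proof -
  let ?\<beta> = "energy_exponent n m p \<gamma>" and ?B = "unit_ball_vol n * r ^ n"
  have weight: "0 \<le> radial_weight n p ?\<beta> r"
    using energy_exponent_pos[OF p \<gamma>] by (simp add: radial_weight_nonneg less_imp_le)
  have "(r ^ n) ^ m = r powr (real n * real m)"
    using r by (simp add: powr_realpow power_mult flip: of_nat_mult)
  moreover have "r powr (- \<gamma> - 1) = r powr (real n * (p - 1) - ?\<beta> - 1) * r powr (real n * real m)"
    by (simp add: energy_exponent_def powr_add[symmetric])
  ultimately have scaling: "radial_weight n p ?\<beta> r * (real (m + 1) * (2 * ?B ^ m))
      = energy_upper_const n m p \<gamma> * (\<gamma> * r powr (- \<gamma> - 1))"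
    using \<gamma> by (simp add: radial_weight_def energy_upper_const_def power_mult_distrib)
  have "ennreal (radial_weight n p ?\<beta> r) * (of_nat (m + 1) * (2 * ennreal ?B ^ m))
      = ennreal (radial_weight n p ?\<beta> r * (real (m + 1) * (2 * ?B ^ m)))"
    using r weight
    by (subst ennreal_power)
      (simp_all add: ennreal_mult ennreal_of_nat_eq_real_of_nat del: of_nat_mult of_nat_add)
  also have "\<dots> = ennreal (energy_upper_const n m p \<gamma>) * ennreal (\<gamma> * r powr (- \<gamma> - 1))"
    unfolding scaling using \<gamma> energy_upper_const_nonneg[OF p \<gamma>] by (intro ennreal_mult) simp_all
  finally show ?thesis .
qed

lemma simplex_energy_le:
  fixes f :: "'a::euclidean_space \<Rightarrow> real"
  assumes f: "locally_integrable f" and p: "1 \<le> p" and \<gamma>: "0 < \<gamma>"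
  shows "simplex_energy p (energy_exponent DIM('a) m p \<gamma>) m f
    \<le> ennreal (energy_upper_const DIM('a) m p \<gamma>) * second_diff_energy p \<gamma> f"
proof -
  note [measurable] = locally_integrable_measurable[OF f]
  let ?C = "energy_upper_const DIM('a) m p \<gamma>" and ?B = "\<lambda>r. unit_ball_vol DIM('a) * r ^ DIM('a)"
  let ?\<kappa> = "radial_weight DIM('a) p (energy_exponent DIM('a) m p \<gamma>)"
  let ?S = "\<lambda>r. \<integral>\<^sup>+x. second_diff_mean f p r x \<partial>lborel"
  have "simplex_energy p (energy_exponent DIM('a) m p \<gamma>) m f
      \<le> (\<integral>\<^sup>+r\<in>{0<..}. ennreal (?\<kappa> r) * (of_nat (m + 1) * (2 * (ennreal (?B r) ^ m * ?S r))) \<partial>lborel)"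
    by (rule simplex_energy_le_radial[OF f p energy_exponent_pos[OF p \<gamma>]])
  also have "\<dots> = (\<integral>\<^sup>+r. ennreal ?C * (ennreal (\<gamma> * r powr (- \<gamma> - 1)) * ?S r * indicator {0<..} r) \<partial>lborel)"
  proof (rule nn_integral_cong)
    fix r :: real
    show "ennreal (?\<kappa> r) * (of_nat (m + 1) * (2 * (ennreal (?B r) ^ m * ?S r))) * indicator {0<..} r
      = ennreal ?C * (ennreal (\<gamma> * r powr (- \<gamma> - 1)) * ?S r * indicator {0<..} r)"
    proof (cases "0 < r")
      case True
      have "ennreal (?\<kappa> r) * (of_nat (m + 1) * (2 * ennreal (?B r) ^ m)) * ?S r
          = ennreal ?C * ennreal (\<gamma> * r powr (- \<gamma> - 1)) * ?S r"
        by (subst radial_weight_mult_eq[OF p \<gamma> True]) (rule refl)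
      thus ?thesis
        by (simp only: mult.assoc)
    qed simp
  qed
  also have "\<dots> = ennreal ?C * (\<integral>\<^sup>+r\<in>{0<..}. ennreal (\<gamma> * r powr (- \<gamma> - 1)) * ?S r \<partial>lborel)"
    by (rule nn_integral_cmult) measurable
  also have "\<dots> = ennreal ?C * second_diff_energy p \<gamma> f"
    by (simp only: second_diff_energy_radial[OF locally_integrable_measurable[OF f] \<gamma>])
  finally show ?thesis .
qed

lemma ex_small_superlevel_set:
  fixes f :: "'a \<Rightarrow> real"
  assumes [measurable]: "f \<in> borel_measurable M" "S \<in> sets M" and "emeasure M S < \<infinity>" "0 < \<epsilon>"
  shows "\<exists>k::nat. emeasure M {y \<in> S. real k < \<bar>f y\<bar>} < \<epsilon>"
proof -
  define A where "A k = {y \<in> S. real k < \<bar>f y\<bar>}" for k :: nat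
  have A_eq: "A k = {y \<in> space M. y \<in> S \<and> real k < \<bar>f y\<bar>}" for k
    using sets.sets_into_space[OF assms(2)] by (auto simp: A_def)
  have "(\<lambda>k. emeasure M (A k)) \<longlonglongrightarrow> emeasure M (\<Inter>k. A k)"
  proof (rule Lim_emeasure_decseq)
    show "range A \<subseteq> sets M"
      unfolding A_eq by auto
    show "decseq A"
      by (auto simp: decseq_def A_def)
    show "emeasure M (A k) \<noteq> \<infinity>" for k
      using emeasure_mono[of "A k" S M] assms by (auto simp: A_def top_unique)
  qed
  moreover have "y \<notin> A (nat \<lceil>\<bar>f y\<bar>\<rceil>)" for y
    by (simp add: A_def of_nat_ceiling leD)
  hence "(\<Inter>k. A k) = {}" by blast
  ultimately have "(\<lambda>k. emeasure M (A k)) \<longlonglongrightarrow> 0" by simp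
  hence "\<forall>\<^sub>F k in sequentially. emeasure M (A k) < \<epsilon>"
    using \<open>0 < \<epsilon>\<close> by (intro order_tendstoD)
  thus ?thesis
    by (auto simp: A_def eventually_sequentially)
qed

text \<open>For most \<open>h\<close> neither \<open>x + h\<close> nor \<open>x - h\<close> lies in the small set where \<open>\<bar>f\<bar>\<close> exceeds \<open>k\<close>.\<close>

lemma abs_indicator_le_second_diff:
  fixes f :: "'a::euclidean_space \<Rightarrow> real"
  assumes x: "x \<in> ball 0 \<rho>" and "0 \<le> k"
  defines "A \<equiv> {y \<in> ball 0 (2 * \<rho>). k < \<bar>f y\<bar>}"
  shows "ennreal \<bar>f x\<bar> * indicator (ball 0 \<rho>) h
    \<le> ennreal k * indicator (ball 0 \<rho>) h + ennreal (\<bar>second_diff f h x\<bar> powr 1) * indicator (ball 0 \<rho>) h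
      + (ennreal \<bar>f x\<bar> * indicator A (x + h) + ennreal \<bar>f x\<bar> * indicator A (x - h))"
proof -
  consider "h \<notin> ball 0 \<rho>" | "x + h \<in> A \<or> x - h \<in> A" | "h \<in> ball 0 \<rho>" "x + h \<notin> A" "x - h \<notin> A"
    by blast
  thus ?thesis
  proof cases
    case 2
    thus ?thesis by (auto simp: indicator_def intro: add_increasing add_increasing2)
  next
    case 3
    have "norm (x + h) < 2 * \<rho>" "norm (x - h) < 2 * \<rho>"
      using norm_triangle_ineq[of x h] norm_triangle_ineq4[of x h] 3(1) x by auto
    hence "\<bar>f (x + h)\<bar> \<le> k" "\<bar>f (x - h)\<bar> \<le> k"
      using 3 by (auto simp: A_def)
    hence "\<bar>f x\<bar> \<le> k + \<bar>second_diff f h x\<bar>"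
      unfolding second_diff_def by linarith
    hence "ennreal \<bar>f x\<bar> \<le> ennreal k + ennreal (\<bar>second_diff f h x\<bar> powr 1)"
      using \<open>0 \<le> k\<close> by (simp add: ennreal_leI flip: ennreal_plus)
    thus ?thesis using 3(1) by (simp add: add_increasing2)
  qed simp
qed

lemma abs_le_second_diff_mean:
  fixes f :: "'a::euclidean_space \<Rightarrow> real"
  assumes f [measurable]: "f \<in> borel_measurable borel" and \<rho>: "0 < \<rho>" and x: "x \<in> ball 0 \<rho>" and "0 \<le> k"
  defines "V \<equiv> unit_ball_vol DIM('a) * \<rho> ^ DIM('a)"
  assumes small: "emeasure lborel {y \<in> ball 0 (2 * \<rho>). k < \<bar>f y\<bar>} \<le> ennreal (V / 4)"
  shows "ennreal (V / 2) * ennreal \<bar>f x\<bar> \<le> ennreal (k * V) + second_diff_mean f 1 \<rho> x"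
proof -
  define A where "A = {y \<in> ball 0 (2 * \<rho>). k < \<bar>f y\<bar>}"
  have [measurable]: "A \<in> sets borel"
    unfolding A_def by measurable
  have V: "0 < V" "emeasure lborel (ball (0::'a) \<rho>) = ennreal V"
    using \<rho> by (simp_all add: V_def emeasure_ball)
  let ?u = "ennreal \<bar>f x\<bar>" and ?\<Delta> = "\<lambda>h. ennreal (\<bar>second_diff f h x\<bar> powr 1)"
  have "ennreal V * ?u = (\<integral>\<^sup>+h. ?u * indicator (ball (0::'a) \<rho>) h \<partial>lborel)"
    by (simp add: nn_integral_cmult_indicator V(2) mult.commute)
  also have "\<dots> \<le> (\<integral>\<^sup>+h. ennreal k * indicator (ball 0 \<rho>) h + ?\<Delta> h * indicator (ball 0 \<rho>) h
      + (?u * indicator A (x + h) + ?u * indicator A (x - h)) \<partial>lborel)"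
    unfolding A_def by (intro nn_integral_mono abs_indicator_le_second_diff x \<open>0 \<le> k\<close>)
  also have "\<dots> = ennreal k * ennreal V + second_diff_mean f 1 \<rho> x
      + (?u * (\<integral>\<^sup>+h. indicator A (x + h) \<partial>lborel) + ?u * (\<integral>\<^sup>+h. indicator A (x - h) \<partial>lborel))"
    unfolding second_diff_mean_def
    by (simp add: nn_integral_add nn_integral_cmult nn_integral_cmult_indicator V(2))
  also have "\<dots> = ennreal k * ennreal V + second_diff_mean f 1 \<rho> x
      + (?u * emeasure lborel A + ?u * emeasure lborel A)"
    by (simp add: nn_integral_lborel_translate[of "indicator A"] nn_integral_lborel_reflect[of "indicator A"])
  also have "\<dots> \<le> ennreal k * ennreal V + second_diff_mean f 1 \<rho> x
      + (?u * ennreal (V / 4) + ?u * ennreal (V / 4))"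
    using small unfolding A_def by (intro add_left_mono add_mono mult_left_mono) simp_all
  also have "?u * ennreal (V / 4) + ?u * ennreal (V / 4) = ennreal (V / 2) * ?u"
    using V(1) by (simp add: mult.commute flip: distrib_left ennreal_plus)
  also have "ennreal k * ennreal V = ennreal (k * V)"
    using V(1) \<open>0 \<le> k\<close> by (simp add: ennreal_mult)
  finally have "ennreal V * ?u \<le> ennreal (k * V) + second_diff_mean f 1 \<rho> x + ennreal (V / 2) * ?u" .
  moreover have "ennreal V * ?u = ennreal (V / 2) * ?u + ennreal (V / 2) * ?u"
    using V(1) by (simp flip: distrib_right ennreal_plus)
  ultimately have "ennreal (V / 2) * ?u + ennreal (V / 2) * ?u
      \<le> ennreal (V / 2) * ?u + (ennreal (k * V) + second_diff_mean f 1 \<rho> x)"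
    by (simp add: add_ac)
  thus ?thesis
    by (simp add: ennreal_add_left_cancel_le ennreal_mult_eq_top_iff)
qed

lemma locally_integrable_if_second_diff_mean_finite:
  fixes f :: "'a::euclidean_space \<Rightarrow> real"
  assumes [measurable]: "f \<in> borel_measurable borel"
    and finite_mean: "\<And>\<rho>. 0 < \<rho> \<Longrightarrow> (\<integral>\<^sup>+x\<in>ball 0 \<rho>. second_diff_mean f 1 \<rho> x \<partial>lborel) < \<infinity>"
  shows "locally_integrable f"
proof -
  have ball_finite: "(\<integral>\<^sup>+x\<in>ball 0 \<rho>. ennreal \<bar>f x\<bar> \<partial>lborel) < \<infinity>" if \<rho>: "0 < \<rho>" for \<rho>
  proof -
    let ?V = "unit_ball_vol DIM('a) * \<rho> ^ DIM('a)"
    have V: "0 < ?V" using \<rho> by simp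
    have "emeasure lborel (ball (0::'a) (2 * \<rho>)) < \<infinity>"
      by (rule emeasure_lborel_ball_finite)
    then obtain k :: nat where k: "emeasure lborel {y \<in> ball 0 (2 * \<rho>). real k < \<bar>f y\<bar>} < ennreal (?V / 4)"
      using ex_small_superlevel_set[of f lborel "ball 0 (2 * \<rho>)" "ennreal (?V / 4)"] V by auto
    have "ennreal (?V / 2) * (\<integral>\<^sup>+x\<in>ball 0 \<rho>. ennreal \<bar>f x\<bar> \<partial>lborel)
        = (\<integral>\<^sup>+x. ennreal (?V / 2) * (ennreal \<bar>f x\<bar> * indicator (ball 0 \<rho>) x) \<partial>lborel)"
      by (rule nn_integral_cmult[symmetric]) measurable
    also have "\<dots> \<le> (\<integral>\<^sup>+x. ennreal (k * ?V) * indicator (ball 0 \<rho>) x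
        + second_diff_mean f 1 \<rho> x * indicator (ball 0 \<rho>) x \<partial>lborel)"
      using abs_le_second_diff_mean[of f \<rho> _ k] k \<rho>
      by (intro nn_integral_mono) (auto simp: indicator_def less_imp_le)
    also have "\<dots> = ennreal (k * ?V) * ennreal ?V + (\<integral>\<^sup>+x\<in>ball 0 \<rho>. second_diff_mean f 1 \<rho> x \<partial>lborel)"
      using \<rho> by (subst nn_integral_add, measurable, subst nn_integral_cmult_indicator)
        (simp_all add: emeasure_ball)
    also have "\<dots> < \<infinity>"
      using finite_mean[OF \<rho>] by (simp add: ennreal_mult_less_top)
    finally show ?thesis
      using V by (auto simp: ennreal_mult_less_top)
  qed
  have "set_integrable lborel (cball 0 R) f" for R
    unfolding set_integrable_def
  proof (rule integrableI_bounded)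
    have "(\<integral>\<^sup>+w. ennreal (norm (indicator (cball 0 R) w *\<^sub>R f w)) \<partial>lborel)
        \<le> (\<integral>\<^sup>+x\<in>ball 0 (\<bar>R\<bar> + 1). ennreal \<bar>f x\<bar> \<partial>lborel)"
      by (intro nn_integral_mono) (auto simp: indicator_def)
    also have "\<dots> < \<infinity>"
      by (rule ball_finite) simp
    finally show "(\<integral>\<^sup>+w. ennreal (norm (indicator (cball 0 R) w *\<^sub>R f w)) \<partial>lborel) < \<infinity>" .
  qed measurable
  thus ?thesis
    by (simp add: locally_integrable_def)
qed

lemma nn_integral_second_diff_mean_le:
  fixes f :: "'a::euclidean_space \<Rightarrow> real"
  assumes [measurable]: "f \<in> borel_measurable borel" and "0 \<le> \<gamma>" "0 \<le> \<rho>"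
  shows "(\<integral>\<^sup>+x. second_diff_mean f p \<rho> x \<partial>lborel) \<le> ennreal (\<rho> powr \<gamma>) * second_diff_energy p \<gamma> f"
proof -
  have "(\<integral>\<^sup>+x. second_diff_mean f p \<rho> x \<partial>lborel)
      \<le> (\<integral>\<^sup>+x. (\<integral>\<^sup>+h. ennreal (\<rho> powr \<gamma>)
        * ennreal (\<bar>second_diff f h x\<bar> powr p / norm h powr \<gamma>) \<partial>lborel) \<partial>lborel)"
    unfolding second_diff_mean_def
  proof (intro nn_integral_mono)
    fix x h :: 'a
    let ?s = "\<bar>second_diff f h x\<bar> powr p"
    show "ennreal ?s * indicator (ball 0 \<rho>) h \<le> ennreal (\<rho> powr \<gamma>) * ennreal (?s / norm h powr \<gamma>)"
    proof (cases "h \<noteq> 0 \<and> norm h < \<rho>")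
      case True
      hence "?s * norm h powr \<gamma> \<le> ?s * \<rho> powr \<gamma>"
        using assms by (intro mult_left_mono powr_mono2) auto
      thus ?thesis
        using True by (simp add: ennreal_mult[symmetric] ennreal_leI field_simps)
    qed auto
  qed
  also have "\<dots> = ennreal (\<rho> powr \<gamma>) * second_diff_energy p \<gamma> f"
    by (simp add: second_diff_energy_def nn_integral_cmult)
  finally show ?thesis .
qed

lemma locally_integrable_if_second_diff_energy_finite:
  fixes f :: "'a::euclidean_space \<Rightarrow> real"
  assumes f [measurable]: "f \<in> borel_measurable borel" and p: "1 \<le> p" and \<gamma>: "0 < \<gamma>"
    and finite_energy: "second_diff_energy p \<gamma> f < \<infinity>"
  shows "locally_integrable f"
proof (rule locally_integrable_if_second_diff_mean_finite[OF f])
  fix \<rho> :: real assume \<rho>: "0 < \<rho>"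
  let ?V = "unit_ball_vol DIM('a) * \<rho> ^ DIM('a)"
  have "(\<integral>\<^sup>+x\<in>ball 0 \<rho>. second_diff_mean f 1 \<rho> x \<partial>lborel)
      \<le> (\<integral>\<^sup>+x. second_diff_mean f p \<rho> x + ennreal ?V * indicator (ball 0 \<rho>) x \<partial>lborel)"
    using second_diff_mean_1_le[OF f, of 1 p \<rho>] p \<rho>
    by (intro nn_integral_mono) (simp add: indicator_def)
  also have "\<dots> = (\<integral>\<^sup>+x. second_diff_mean f p \<rho> x \<partial>lborel) + ennreal ?V * emeasure lborel (ball (0::'a) \<rho>)"
    by (simp add: nn_integral_add nn_integral_cmult_indicator)
  also have "\<dots> \<le> ennreal (\<rho> powr \<gamma>) * second_diff_energy p \<gamma> f + ennreal ?V * emeasure lborel (ball (0::'a) \<rho>)"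
    using \<gamma> \<rho> by (intro add_right_mono nn_integral_second_diff_mean_le f) simp_all
  also have "\<dots> < \<infinity>"
    using finite_energy emeasure_lborel_ball_finite[of "0::'a" \<rho>] by (simp add: ennreal_mult_less_top)
  finally show "(\<integral>\<^sup>+x\<in>ball 0 \<rho>. second_diff_mean f 1 \<rho> x \<partial>lborel) < \<infinity>" .
qed

lemma simplex_energy_upper_bound:
  fixes f :: "'a::euclidean_space \<Rightarrow> real" and m :: nat
  assumes f: "f \<in> borel_measurable borel" and p: "1 \<le> p" and \<gamma>: "0 < \<gamma>"
  defines "C \<equiv> max 1 (energy_upper_const DIM('a) m p \<gamma>)"
  shows "simplex_energy p (energy_exponent DIM('a) m p \<gamma>) m f \<le> ennreal C * second_diff_energy p \<gamma> f"
proof (cases "second_diff_energy p \<gamma> f < \<infinity>")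
  case True
  hence "locally_integrable f"
    using locally_integrable_if_second_diff_energy_finite f p \<gamma> by blast
  hence "simplex_energy p (energy_exponent DIM('a) m p \<gamma>) m f
      \<le> ennreal (energy_upper_const DIM('a) m p \<gamma>) * second_diff_energy p \<gamma> f"
    using p \<gamma> by (rule simplex_energy_le)
  also have "\<dots> \<le> ennreal C * second_diff_energy p \<gamma> f"
    unfolding C_def by (intro mult_right_mono ennreal_leI) simp_all
  finally show ?thesis .
next
  case False
  hence "second_diff_energy p \<gamma> f = \<infinity>"
    by (simp add: less_top[symmetric])
  thus ?thesis by (simp add: C_def ennreal_mult_top)
qed

subsection \<open>Measurability of the simplex density\<close>

lemma in_convex_hull_iff_dense:
  fixes S :: "'a::euclidean_space set"
  assumes D: "\<And>U. open U \<Longrightarrow> U \<noteq> {} \<Longrightarrow> \<exists>d\<in>D. d \<in> U" and S: "finite S" "S \<noteq> {}"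
  shows "y \<in> convex hull S \<longleftrightarrow> (\<forall>c\<in>D. \<exists>s\<in>S. c \<bullet> y \<le> c \<bullet> s)"
proof (intro iffI ballI)
  fix c assume y: "y \<in> convex hull S"
  show "\<exists>s\<in>S. c \<bullet> y \<le> c \<bullet> s"
  proof (rule ccontr)
    assume "\<not> ?thesis"
    hence "S \<subseteq> {z. c \<bullet> z < c \<bullet> y}" by auto
    hence "convex hull S \<subseteq> {z. c \<bullet> z < c \<bullet> y}"
      by (intro hull_minimal convex_halfspace_lt)
    thus False using y by auto
  qed
next
  assume dominated: "\<forall>c\<in>D. \<exists>s\<in>S. c \<bullet> y \<le> c \<bullet> s"
  show "y \<in> convex hull S"
  proof (rule ccontr)
    assume y: "y \<notin> convex hull S"
    have "closed (convex hull S)"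
      using S by (intro compact_imp_closed finite_imp_compact_convex_hull)
    from separating_hyperplane_closed_point[OF convex_convex_hull this y]
    obtain a b where a: "a \<bullet> y < b" "\<And>x. x \<in> convex hull S \<Longrightarrow> b < a \<bullet> x" by auto
    let ?U = "\<Inter>s\<in>S. {c. c \<bullet> (s - y) < 0}"
    have "open ?U"
      using S by (intro open_INT ballI open_Collect_less continuous_intros)
    moreover have "- a \<in> ?U"
    proof
      fix s assume "s \<in> S"
      hence "b < a \<bullet> s" by (intro a(2) hull_inc)
      thus "- a \<in> {c. c \<bullet> (s - y) < 0}" using a(1) by (simp add: inner_diff_right)
    qed
    ultimately obtain d where "d \<in> D" "d \<in> ?U" using D by blast
    thus False using dominated by (force simp: inner_diff_right)
  qed
qed

lemma borel_measurable_measure_convex_hull: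
  fixes P :: "'i \<Rightarrow> 'm \<Rightarrow> 'a::euclidean_space"
  assumes I: "finite I" and P: "\<And>i. i \<in> I \<Longrightarrow> P i \<in> borel_measurable M"
  shows "(\<lambda>z. measure lebesgue (convex hull ((\<lambda>i. P i z) ` I))) \<in> borel_measurable M"
proof (cases "I = {}")
  case False
  obtain D :: "'a set" where D: "countable D" "\<And>U. open U \<Longrightarrow> U \<noteq> {} \<Longrightarrow> \<exists>d\<in>D. d \<in> U"
    by (erule countable_dense_setE)
  let ?M = "M \<Otimes>\<^sub>M (lborel :: 'a measure)"
  let ?Q = "{q \<in> space ?M. snd q \<in> convex hull ((\<lambda>i. P i (fst q)) ` I)}"
  have "?Q = {q \<in> space ?M. \<forall>c\<in>D. \<exists>i\<in>I. c \<bullet> snd q \<le> c \<bullet> P i (fst q)}"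
    using I False by (subst in_convex_hull_iff_dense[OF D(2)]) auto
  also have "\<dots> \<in> sets ?M"
  proof (intro sets.sets_Collect_countable_All' D(1) sets.sets_Collect_finite_Ex I)
    fix c i assume "i \<in> I"
    note [measurable] = P[OF this]
    show "{q \<in> space ?M. c \<bullet> snd q \<le> c \<bullet> P i (fst q)} \<in> sets ?M"
      by measurable
  qed
  finally have "(\<lambda>z. measure lborel (Pair z -` ?Q)) \<in> borel_measurable M"
    unfolding measure_def by (intro borel_measurable_enn2real lborel.measurable_emeasure_Pair)
  moreover have "measure lborel (Pair z -` ?Q) = measure lebesgue (convex hull ((\<lambda>i. P i z) ` I))"
    if "z \<in> space M" for z
  proof -
    have "Pair z -` ?Q = convex hull ((\<lambda>i. P i z) ` I)"
      using that by (auto simp: space_pair_measure)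
    thus ?thesis
      using I by (simp add: measure_completion sets_borel_convex_hull_finite)
  qed
  ultimately show ?thesis
    by (rule measurable_cong[THEN iffD1, rotated])
qed simp

lemma diameter_finite:
  assumes "finite S" "S \<noteq> {}"
  shows "diameter S = Max (case_prod dist ` (S \<times> S))"
  using assms by (simp add: diameter_def cSup_eq_Max)

lemma borel_measurable_diameter_image:
  fixes P :: "'i \<Rightarrow> 'm \<Rightarrow> 'a::euclidean_space"
  assumes I: "finite I" and P: "\<And>i. i \<in> I \<Longrightarrow> P i \<in> borel_measurable M"
  shows "(\<lambda>z. diameter ((\<lambda>i. P i z) ` I)) \<in> borel_measurable M"
proof (cases "I = {}")
  case False
  have "case_prod dist ` (((\<lambda>i. P i z) ` I) \<times> ((\<lambda>i. P i z) ` I))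
      = (\<lambda>q. dist (P (fst q) z) (P (snd q) z)) ` (I \<times> I)" for z
    by force
  hence "diameter ((\<lambda>i. P i z) ` I) = Max ((\<lambda>q. dist (P (fst q) z) (P (snd q) z)) ` (I \<times> I))" for z
    using I False by (simp add: diameter_finite)
  moreover have "(\<lambda>z. Max ((\<lambda>q. dist (P (fst q) z) (P (snd q) z)) ` (I \<times> I))) \<in> borel_measurable M"
    using I P by (intro borel_measurable_Max borel_measurable_dist) auto
  ultimately show ?thesis by simp
qed simp

lemma borel_measurable_graph_hull_volume:
  fixes P :: "'i \<Rightarrow> 'm \<Rightarrow> 'a::euclidean_space"
  assumes f [measurable]: "f \<in> borel_measurable borel"
    and I: "finite I" and P: "\<And>i. i \<in> I \<Longrightarrow> P i \<in> borel_measurable M"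
  shows "(\<lambda>z. graph_hull_volume f ((\<lambda>i. P i z) ` I)) \<in> borel_measurable M"
  unfolding graph_hull_volume_def image_image
proof (rule borel_measurable_measure_convex_hull[OF I])
  fix i assume "i \<in> I"
  note [measurable] = P[OF this]
  show "(\<lambda>z. graph_pt f (P i z)) \<in> borel_measurable M"
    unfolding graph_pt_def borel_prod[symmetric] by measurable
qed

lemma borel_measurable_simplex_density:
  fixes P :: "'i \<Rightarrow> 'm \<Rightarrow> 'a::euclidean_space"
  assumes "f \<in> borel_measurable borel" "finite I" "\<And>i. i \<in> I \<Longrightarrow> P i \<in> borel_measurable M"
  shows "(\<lambda>z. simplex_density p \<beta> f ((\<lambda>i. P i z) ` I)) \<in> borel_measurable M"
proof -
  note [measurable] = borel_measurable_graph_hull_volume[OF assms]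
    borel_measurable_diameter_image[OF assms(2,3)]
  show ?thesis
    unfolding simplex_density_def by measurable
qed

subsection \<open>The lower bound for Borel functions\<close>

lemma simplex_density_ge:
  fixes z :: "'a::euclidean_space \<Rightarrow> 'a"
  assumes z: "\<And>b. b \<in> Basis \<Longrightarrow> norm (z b - x - norm (y - x) *\<^sub>R b) \<le> norm (y - x) / (2 * real DIM('a))"
    and u: "0 \<le> u" "u \<le> graph_hull_volume f (insert y (insert x (z ` Basis)))"
    and p: "0 \<le> p" and \<beta>: "0 \<le> \<beta>" and y: "y \<noteq> x"
  shows "ennreal (u powr p / (4 * norm (y - x)) powr \<beta>)
    \<le> simplex_density p \<beta> f (insert y (insert x (z ` Basis)))"
proof -
  let ?A = "insert y (insert x (z ` Basis))" and ?r = "norm (y - x)"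
  have r: "0 < ?r" using y by simp
  have near: "norm (v - x) \<le> 2 * ?r" if v: "v \<in> ?A" for v
  proof -
    consider "v = y" | "v = x" | b where "b \<in> Basis" "v = z b"
      using v by blast
    thus ?thesis
    proof cases
      case 3
      have "?r / (2 * real DIM('a)) \<le> ?r / 1"
        using r by (intro divide_left_mono) (auto simp: Suc_le_eq order_trans[of 1 "real DIM('a)"])
      thus ?thesis
        using z[OF 3(1)] norm_triangle_sub[of "v - x" "?r *\<^sub>R b"] 3 by simp
    qed (use r in auto)
  qed
  have "diameter ?A \<le> 4 * ?r"
  proof (rule diameter_le)
    fix v w assume "v \<in> ?A" "w \<in> ?A"
    thus "norm (v - w) \<le> 4 * ?r"
      using near[of v] near[of w] norm_triangle_ineq4[of "v - x" "w - x"] by simp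
  qed simp
  moreover have "?r \<le> diameter ?A"
    using diameter_bounded_bound[of ?A y x] by (simp add: dist_norm finite_imp_bounded)
  ultimately have "diameter ?A powr \<beta> \<le> (4 * ?r) powr \<beta>" "0 < diameter ?A powr \<beta>"
    using r \<beta> by (auto intro!: powr_mono2)
  moreover have "u powr p \<le> graph_hull_volume f ?A powr p"
    using u p by (intro powr_mono2)
  ultimately show ?thesis
    unfolding simplex_density_def by (intro ennreal_leI frac_le) auto
qed

definition pair_density_bound :: "nat \<Rightarrow> real \<Rightarrow> real \<Rightarrow> real \<Rightarrow> real \<Rightarrow> real" where
  "pair_density_bound n p \<beta> r d = (graph_simplex_const n * r ^ n * d / 2) powr p / (4 * r) powr \<beta>"

lemma simplex_density_pair_ge:
  fixes z :: "'a::euclidean_space \<Rightarrow> 'a"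
  assumes h: "h \<noteq> 0" and z: "\<And>b. b \<in> Basis \<Longrightarrow> norm (z b - x - norm h *\<^sub>R b) \<le> norm h / (2 * real DIM('a))"
    and p: "0 \<le> p" and \<beta>: "0 \<le> \<beta>"
  shows "ennreal (pair_density_bound DIM('a) p \<beta> (norm h) \<bar>second_diff f h x\<bar>)
    \<le> simplex_density p \<beta> f (insert (x + h) (insert x (z ` Basis)))
      + simplex_density p \<beta> f (insert (x - h) (insert x (z ` Basis)))"
proof -
  define k where "k = graph_simplex_const DIM('a) * norm h ^ DIM('a)"
  have k: "0 < k"
    using h by (simp add: k_def graph_simplex_const_pos)
  let ?u = "k * \<bar>second_diff f h x\<bar> / 2" and ?d = "(4 * norm h) powr \<beta>"
  obtain c where c: "\<And>y. k * \<bar>f y - f x - c \<bullet> (y - x)\<bar> \<le> graph_hull_volume f (insert y (insert x (z ` Basis)))"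
    using graph_simplex_volume_ge[of "norm h" z x f] h z unfolding k_def by auto
  let ?e = "\<lambda>y. f y - f x - c \<bullet> (y - x)"
  have "\<bar>second_diff f h x\<bar> \<le> \<bar>?e (x + h)\<bar> + \<bar>?e (x - h)\<bar>"
    by (simp add: second_diff_def)
  hence "\<bar>second_diff f h x\<bar> / 2 \<le> max \<bar>?e (x + h)\<bar> \<bar>?e (x - h)\<bar>"
    by linarith
  hence "?u \<le> k * max \<bar>?e (x + h)\<bar> \<bar>?e (x - h)\<bar>"
    using k by simp
  then consider "?u \<le> graph_hull_volume f (insert (x + h) (insert x (z ` Basis)))"
    | "?u \<le> graph_hull_volume f (insert (x - h) (insert x (z ` Basis)))"
    using c[of "x + h"] c[of "x - h"] by (auto simp: max_def split: if_splits intro: order_trans)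
  thus ?thesis
  proof cases
    case 1
    hence "ennreal (?u powr p / ?d) \<le> simplex_density p \<beta> f (insert (x + h) (insert x (z ` Basis)))"
      using simplex_density_ge[of z x "x + h" ?u f p \<beta>] z k p \<beta> h by simp
    thus ?thesis by (simp add: pair_density_bound_def k_def add_increasing2)
  next
    case 2
    hence "ennreal (?u powr p / ?d) \<le> simplex_density p \<beta> f (insert (x - h) (insert x (z ` Basis)))"
      using simplex_density_ge[of z x "x - h" ?u f p \<beta>] z k p \<beta> h by simp
    thus ?thesis by (simp add: pair_density_bound_def k_def add_increasing)
  qed
qed

definition edge_energy :: "real \<Rightarrow> real \<Rightarrow> nat \<Rightarrow> ('a::euclidean_space \<Rightarrow> real) \<Rightarrow> 'a \<Rightarrow> 'a \<Rightarrow> ennreal" where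
  "edge_energy p \<beta> m f x y =
    (\<integral>\<^sup>+Z. simplex_density p \<beta> f (insert y (insert x (Z ` {2..m}))) \<partial>PiM {2..m} (\<lambda>_. lborel))"

lemma insert_edge_eq_image:
  fixes m :: nat
  assumes "1 \<le> m"
  shows "insert y (insert x (Z ` {2..m})) = (\<lambda>i. if i = 0 then x else if i = 1 then y else Z i) ` {..m}"
proof -
  have "{..m} = insert 0 (insert 1 {2..m})"
    using assms by auto
  thus ?thesis by auto
qed

lemma borel_measurable_simplex_density_edge:
  fixes a b :: "'m \<Rightarrow> 'a::euclidean_space" and m :: nat
  assumes "f \<in> borel_measurable borel" "1 \<le> m" "a \<in> borel_measurable M" "b \<in> borel_measurable M"
    and Z: "\<And>i. i \<in> {2..m} \<Longrightarrow> (\<lambda>z. Z z i) \<in> borel_measurable M"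
  shows "(\<lambda>z. simplex_density p \<beta> f (insert (b z) (insert (a z) (Z z ` {2..m})))) \<in> borel_measurable M"
  unfolding insert_edge_eq_image[OF \<open>1 \<le> m\<close>]
proof (rule borel_measurable_simplex_density)
  fix i assume "i \<in> {..m}"
  thus "(\<lambda>z. if i = 0 then a z else if i = 1 then b z else Z z i) \<in> borel_measurable M"
    using assms by (cases "i = 0"; cases "i = 1") auto
qed (use assms in auto)

lemma edge_energy_measurable [measurable]:
  fixes a b :: "'m \<Rightarrow> 'a::euclidean_space"
  assumes f: "f \<in> borel_measurable borel" and m: "1 \<le> m"
    and a: "a \<in> borel_measurable M" and b: "b \<in> borel_measurable M"
  shows "(\<lambda>z. edge_energy p \<beta> m f (a z) (b z)) \<in> borel_measurable M"
proof -
  interpret product_sigma_finite "\<lambda>_. lborel :: 'a measure" by (rule product_sigma_finite_lborel)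
  interpret fin: finite_product_sigma_finite "\<lambda>_. lborel :: 'a measure" "{2..m}" by standard simp
  show ?thesis
    unfolding edge_energy_def
  proof (rule fin.borel_measurable_nn_integral, unfold split_beta',
      rule borel_measurable_simplex_density_edge[OF f m])
    show "(\<lambda>q. snd q i) \<in> borel_measurable (M \<Otimes>\<^sub>M PiM {2..m} (\<lambda>_. lborel :: 'a measure))" if "i \<in> {2..m}" for i
      using that by (intro measurable_compose[OF measurable_snd measurable_component_lborel])
  qed (use a b in \<open>simp_all add: measurable_compose[OF measurable_fst]\<close>)
qed

lemma simplex_energy_eq_edge_energy:
  fixes f :: "'a::euclidean_space \<Rightarrow> real"
  assumes f: "f \<in> borel_measurable borel" and m: "1 \<le> m"
  shows "simplex_energy p \<beta> m f = (\<integral>\<^sup>+x. (\<integral>\<^sup>+y. edge_energy p \<beta> m f x y \<partial>lborel) \<partial>lborel)"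
proof -
  interpret product_sigma_finite "\<lambda>_. lborel :: 'a measure" by (rule product_sigma_finite_lborel)
  have indices: "{..m} = insert 0 (insert 1 {2..m})"
    using m by auto
  have "simplex_energy p \<beta> m f
      = (\<integral>\<^sup>+x. (\<integral>\<^sup>+Y. simplex_density p \<beta> f ((Y(0 := x)) ` {..m}) \<partial>PiM (insert 1 {2..m}) (\<lambda>_. lborel)) \<partial>lborel)"
    unfolding simplex_energy_def indices
  proof (rule product_nn_integral_insert_rev)
    show "(\<lambda>X. simplex_density p \<beta> f (X ` insert 0 (insert 1 {2..m})))
        \<in> borel_measurable (PiM (insert 0 (insert 1 {2..m})) (\<lambda>_. lborel))"
      by (rule borel_measurable_simplex_density[OF f _ measurable_component_lborel]) simp_all
  qed simp_all
  also have "\<dots> = (\<integral>\<^sup>+x. (\<integral>\<^sup>+y. edge_energy p \<beta> m f x y \<partial>lborel) \<partial>lborel)"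
  proof (rule nn_integral_cong)
    fix x :: 'a
    have "(\<integral>\<^sup>+Y. simplex_density p \<beta> f ((Y(0 := x)) ` {..m}) \<partial>PiM (insert 1 {2..m}) (\<lambda>_. lborel))
        = (\<integral>\<^sup>+Y. simplex_density p \<beta> f (insert (Y 1) (insert x (Y ` {2..m})))
          \<partial>PiM (insert 1 {2..m}) (\<lambda>_. lborel))"
      unfolding indices by (intro nn_integral_cong arg_cong[where f="simplex_density p \<beta> f"]) auto
    also have "\<dots> = (\<integral>\<^sup>+y. (\<integral>\<^sup>+Z. simplex_density p \<beta> f
        (insert ((Z(1 := y)) 1) (insert x ((Z(1 := y)) ` {2..m}))) \<partial>PiM {2..m} (\<lambda>_. lborel)) \<partial>lborel)"
      using f m by (intro product_nn_integral_insert_rev borel_measurable_simplex_density_edge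
        measurable_component_lborel) auto
    also have "\<dots> = (\<integral>\<^sup>+y. edge_energy p \<beta> m f x y \<partial>lborel)"
      unfolding edge_energy_def by (intro nn_integral_cong arg_cong[where f="simplex_density p \<beta> f"]) auto
    finally show "(\<integral>\<^sup>+Y. simplex_density p \<beta> f ((Y(0 := x)) ` {..m}) \<partial>PiM (insert 1 {2..m}) (\<lambda>_. lborel))
        = (\<integral>\<^sup>+y. edge_energy p \<beta> m f x y \<partial>lborel)" .
  qed
  finally show ?thesis .
qed

lemma nn_integral_ge_prod_ball:
  fixes a :: "'i \<Rightarrow> 'a::euclidean_space"
  assumes J: "finite J" and r: "0 \<le> r" and F: "\<And>Z. (\<And>j. j \<in> J \<Longrightarrow> Z j \<in> ball (a j) r) \<Longrightarrow> L \<le> F Z"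
  shows "L * ennreal (unit_ball_vol DIM('a) * r ^ DIM('a)) ^ card J \<le> (\<integral>\<^sup>+Z. F Z \<partial>PiM J (\<lambda>_. lborel))"
proof -
  let ?near = "\<lambda>Z. \<Prod>j\<in>J. indicator (ball (a j) r) (Z j) :: ennreal"
  have [measurable]: "?near \<in> borel_measurable (PiM J (\<lambda>_. lborel))"
  proof (rule borel_measurable_prod_ennreal)
    fix j assume "j \<in> J"
    note [measurable] = measurable_component_lborel[OF this, where 'a='a]
    show "(\<lambda>Z. indicator (ball (a j) r) (Z j) :: ennreal) \<in> borel_measurable (PiM J (\<lambda>_. lborel))"
      by measurable
  qed
  have "L * ennreal (unit_ball_vol DIM('a) * r ^ DIM('a)) ^ card J = (\<integral>\<^sup>+Z. L * ?near Z \<partial>PiM J (\<lambda>_. lborel))"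
    by (simp add: nn_integral_cmult nn_integral_prod_ball[OF J r])
  also have "\<dots> \<le> (\<integral>\<^sup>+Z. F Z \<partial>PiM J (\<lambda>_. lborel))"
  proof (rule nn_integral_mono)
    fix Z :: "'i \<Rightarrow> 'a"
    show "L * ?near Z \<le> F Z"
    proof (cases "\<forall>j\<in>J. Z j \<in> ball (a j) r")
      case True
      hence "?near Z = 1"
        by (intro prod.neutral) (simp add: indicator_def)
      thus ?thesis using F[of Z] True by simp
    next
      case False
      hence "?near Z = 0"
        using J by (intro prod_zero) (auto simp: indicator_def)
      thus ?thesis by (simp only: mult_zero_right zero_le)
    qed
  qed
  finally show ?thesis .
qed

lemma simplex_density_pair_indexed_ge:
  fixes f :: "'a::euclidean_space \<Rightarrow> real" and e Z :: "'i \<Rightarrow> 'a"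
  assumes e: "bij_betw e J Basis" and h: "h \<noteq> 0" and p: "0 \<le> p" and \<beta>: "0 \<le> \<beta>"
    and Z: "\<And>j. j \<in> J \<Longrightarrow> Z j \<in> ball (x + norm h *\<^sub>R e j) (norm h / (2 * real DIM('a)))"
  shows "ennreal (pair_density_bound DIM('a) p \<beta> (norm h) \<bar>second_diff f h x\<bar>)
    \<le> simplex_density p \<beta> f (insert (x + h) (insert x (Z ` J)))
      + simplex_density p \<beta> f (insert (x - h) (insert x (Z ` J)))"
proof -
  let ?z = "Z \<circ> inv_into J e"
  have "inv_into J e ` Basis = J"
    using bij_betw_inv_into[OF e] by (simp add: bij_betw_def)
  hence image: "?z ` Basis = Z ` J"
    by (simp only: image_comp[symmetric])
  have "norm (?z b - x - norm h *\<^sub>R b) \<le> norm h / (2 * real DIM('a))" if b: "b \<in> Basis" for b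
  proof -
    have "inv_into J e b \<in> J" "e (inv_into J e b) = b"
      using e b inv_into_into[of b e J] f_inv_into_f[of b e J] by (simp_all add: bij_betw_def)
    thus ?thesis
      using Z[of "inv_into J e b"] by (simp add: dist_norm norm_minus_commute diff_diff_eq)
  qed
  from simplex_density_pair_ge[OF h this p \<beta>, of f] show ?thesis
    unfolding image .
qed

definition energy_lower_const :: "nat \<Rightarrow> real \<Rightarrow> real \<Rightarrow> real" where
  "energy_lower_const n p \<gamma> = (graph_simplex_const n / 2) powr p / 4 powr energy_exponent n (n + 1) p \<gamma>
    * (unit_ball_vol n * (1 / (2 * real n)) ^ n) ^ n"

lemma energy_lower_const_pos: "0 < n \<Longrightarrow> 0 < energy_lower_const n p \<gamma>"
  unfolding energy_lower_const_def using graph_simplex_const_pos[of n]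
  by (intro mult_pos_pos divide_pos_pos zero_less_power) auto

lemma pair_density_bound_mult_eq:
  fixes d r p \<gamma> :: real
  assumes r: "0 < r" and n: "0 < n" and "0 \<le> d"
  shows "pair_density_bound n p (energy_exponent n (n + 1) p \<gamma>) r d
    * (unit_ball_vol n * (r / (2 * real n)) ^ n) ^ n
    = energy_lower_const n p \<gamma> * (d powr p / r powr \<gamma>)"
proof -
  let ?\<beta> = "energy_exponent n (n + 1) p \<gamma>"
  have \<beta>_eq: "?\<beta> = \<gamma> + real n * p + real n * real n"
    by (simp add: energy_exponent_def algebra_simps)
  have simplex: "pair_density_bound n p ?\<beta> r d
      = (graph_simplex_const n / 2) powr p / 4 powr ?\<beta> * d powr p * (r powr (real n * p) / r powr ?\<beta>)"
    using r \<open>0 \<le> d\<close> graph_simplex_const_pos[OF n]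
    by (simp add: pair_density_bound_def powr_mult powr_divide powr_realpow[symmetric] powr_powr mult_ac)
  have balls: "(unit_ball_vol n * (r / (2 * real n)) ^ n) ^ n
      = (unit_ball_vol n * (1 / (2 * real n)) ^ n) ^ n * r powr (real n * real n)"
  proof -
    have "(r ^ n) ^ n = r powr (real n * real n)"
      using r by (simp add: powr_realpow[symmetric] powr_powr)
    moreover have "unit_ball_vol n * (r / (2 * real n)) ^ n
        = (unit_ball_vol n * (1 / (2 * real n)) ^ n) * r ^ n"
      by (simp add: power_divide)
    ultimately show ?thesis by (simp only: power_mult_distrib)
  qed
  have exponents: "d powr p / r powr \<gamma>
      = d powr p * (r powr (real n * p) / r powr ?\<beta> * r powr (real n * real n))"
    unfolding \<beta>_eq using r by (simp add: powr_add)
  show ?thesis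
    unfolding energy_lower_const_def exponents simplex balls by (simp only: mult_ac)
qed

lemma edge_energy_pair_ge:
  fixes f :: "'a::euclidean_space \<Rightarrow> real"
  assumes f: "f \<in> borel_measurable borel" and p: "1 \<le> p" and \<gamma>: "0 < \<gamma>"
  defines "n \<equiv> DIM('a)"
  defines "\<beta> \<equiv> energy_exponent n (n + 1) p \<gamma>"
  shows "ennreal (energy_lower_const n p \<gamma>) * ennreal (\<bar>second_diff f h x\<bar> powr p / norm h powr \<gamma>)
    \<le> edge_energy p \<beta> (n + 1) f x (x + h) + edge_energy p \<beta> (n + 1) f x (x - h)"
proof (cases "h = 0")
  case False
  let ?J = "{2..n + 1}" and ?L = "pair_density_bound n p \<beta> (norm h) \<bar>second_diff f h x\<bar>"
  let ?B = "unit_ball_vol n * (norm h / (2 * real n)) ^ n"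
  let ?dens = "\<lambda>y Z. simplex_density p \<beta> f (insert y (insert x (Z ` ?J)))"
  have n: "0 < n" by (simp add: n_def)
  have \<beta>: "0 \<le> \<beta>" using energy_exponent_pos[OF p \<gamma>] by (simp add: \<beta>_def less_imp_le)
  have "?L * ?B ^ n = energy_lower_const n p \<gamma> * (\<bar>second_diff f h x\<bar> powr p / norm h powr \<gamma>)"
    unfolding \<beta>_def using False n by (intro pair_density_bound_mult_eq) simp_all
  hence "ennreal (energy_lower_const n p \<gamma>) * ennreal (\<bar>second_diff f h x\<bar> powr p / norm h powr \<gamma>)
      = ennreal ?L * ennreal ?B ^ n"
    using energy_lower_const_pos[OF n]
    by (simp add: pair_density_bound_def ennreal_mult[symmetric] ennreal_power less_imp_le)
  also have "\<dots> \<le> (\<integral>\<^sup>+Z. ?dens (x + h) Z + ?dens (x - h) Z \<partial>PiM ?J (\<lambda>_. lborel))"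
  proof -
    have card: "card ?J = n" by simp
    then obtain e where e: "bij_betw e ?J (Basis :: 'a set)"
      using finite_same_card_bij[of ?J "Basis :: 'a set"] by (auto simp: n_def)
    show ?thesis
      using nn_integral_ge_prod_ball[of ?J "norm h / (2 * real n)" "\<lambda>j. x + norm h *\<^sub>R e j"]
        simplex_density_pair_indexed_ge[OF e False _ \<beta>] p card by (simp add: n_def)
  qed
  also have "\<dots> = edge_energy p \<beta> (n + 1) f x (x + h) + edge_energy p \<beta> (n + 1) f x (x - h)"
    unfolding edge_energy_def
    by (intro nn_integral_add borel_measurable_simplex_density_edge f measurable_component_lborel) simp_all
  finally show ?thesis .
qed simp

lemma simplex_energy_lower_bound:
  fixes f :: "'a::euclidean_space \<Rightarrow> real"
  assumes f [measurable]: "f \<in> borel_measurable borel" and p: "1 \<le> p" and \<gamma>: "0 < \<gamma>"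
  defines "n \<equiv> DIM('a)"
  defines "\<beta> \<equiv> energy_exponent n (n + 1) p \<gamma>"
  shows "ennreal (energy_lower_const n p \<gamma> / 2) * second_diff_energy p \<gamma> f \<le> simplex_energy p \<beta> (n + 1) f"
proof -
  let ?c = "energy_lower_const n p \<gamma>" and ?E = "simplex_energy p \<beta> (n + 1) f"
    and ?\<Phi> = "edge_energy p \<beta> (n + 1) f"
  have [measurable]: "(\<lambda>z. ?\<Phi> (a z) (b z)) \<in> borel_measurable M"
    if "a \<in> borel_measurable M" "b \<in> borel_measurable M" for a b :: "'m \<Rightarrow> 'a" and M
    using that by (intro edge_energy_measurable f) simp_all
  have iterated: "?E = (\<integral>\<^sup>+x. (\<integral>\<^sup>+y. ?\<Phi> x y \<partial>lborel) \<partial>lborel)"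
    by (rule simplex_energy_eq_edge_energy[OF f]) simp
  have plus: "?E = (\<integral>\<^sup>+x. (\<integral>\<^sup>+h. ?\<Phi> x (x + h) \<partial>lborel) \<partial>lborel)"
    unfolding iterated by (intro nn_integral_cong nn_integral_lborel_translate[symmetric]) measurable
  have minus: "?E = (\<integral>\<^sup>+x. (\<integral>\<^sup>+h. ?\<Phi> x (x - h) \<partial>lborel) \<partial>lborel)"
    unfolding iterated by (intro nn_integral_cong nn_integral_lborel_reflect[symmetric]) measurable
  have "ennreal ?c * second_diff_energy p \<gamma> f
      = (\<integral>\<^sup>+x. (\<integral>\<^sup>+h. ennreal ?c * ennreal (\<bar>second_diff f h x\<bar> powr p / norm h powr \<gamma>) \<partial>lborel) \<partial>lborel)"
    by (simp add: second_diff_energy_def nn_integral_cmult)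
  also have "\<dots> \<le> (\<integral>\<^sup>+x. (\<integral>\<^sup>+h. ?\<Phi> x (x + h) + ?\<Phi> x (x - h) \<partial>lborel) \<partial>lborel)"
    unfolding n_def \<beta>_def by (intro nn_integral_mono edge_energy_pair_ge f p \<gamma>)
  also have "\<dots> = ?E + ?E"
    by (subst (2) minus, subst plus) (simp add: nn_integral_add)
  finally have "ennreal (1 / 2) * (ennreal ?c * second_diff_energy p \<gamma> f) \<le> ennreal (1 / 2) * (2 * ?E)"
    by (intro mult_left_mono) (simp_all add: mult_2)
  moreover have "ennreal (1 / 2) * 2 = 1"
    using ennreal_mult[of "1 / 2" 2] by simp
  moreover have "ennreal (?c / 2) = ennreal (1 / 2) * ennreal ?c"
    using ennreal_mult[of "1 / 2" ?c] energy_lower_const_pos[of n p \<gamma>] by (simp add: n_def)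
  ultimately show ?thesis
    by (simp add: mult.assoc[symmetric])
qed

lemma simplex_energy_comparable:
  assumes p: "1 \<le> p" and \<gamma>: "0 < \<gamma>"
  defines "\<beta> \<equiv> energy_exponent DIM('a) (DIM('a) + 1) p \<gamma>"
  obtains C where "0 < C" "\<And>f :: 'a::euclidean_space \<Rightarrow> real. f \<in> borel_measurable borel \<Longrightarrow>
      ennreal (1 / C) * second_diff_energy p \<gamma> f \<le> simplex_energy p \<beta> (DIM('a) + 1) f
      \<and> simplex_energy p \<beta> (DIM('a) + 1) f \<le> ennreal C * second_diff_energy p \<gamma> f"
proof -
  define A where "A = max 1 (energy_upper_const DIM('a) (DIM('a) + 1) p \<gamma>)"
  define b where "b = energy_lower_const DIM('a) p \<gamma> / 2"
  have b: "0 < b"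
    by (simp add: b_def energy_lower_const_pos)
  let ?C = "max A (1 / b)"
  show thesis
  proof (rule that[of ?C])
    show C: "0 < ?C" by (simp add: A_def)
    fix f :: "'a \<Rightarrow> real" assume f: "f \<in> borel_measurable borel"
    have "1 / ?C \<le> 1 / (1 / b)"
      using b C by (intro divide_left_mono) auto
    hence "ennreal (1 / ?C) * second_diff_energy p \<gamma> f \<le> ennreal b * second_diff_energy p \<gamma> f"
      by (intro mult_right_mono ennreal_leI) simp_all
    also have "\<dots> \<le> simplex_energy p \<beta> (DIM('a) + 1) f"
      unfolding b_def \<beta>_def by (rule simplex_energy_lower_bound[OF f p \<gamma>])
    finally have lower: "ennreal (1 / ?C) * second_diff_energy p \<gamma> f \<le> simplex_energy p \<beta> (DIM('a) + 1) f" .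
    have "simplex_energy p \<beta> (DIM('a) + 1) f \<le> ennreal A * second_diff_energy p \<gamma> f"
      unfolding A_def \<beta>_def by (rule simplex_energy_upper_bound[OF f p \<gamma>])
    also have "\<dots> \<le> ennreal ?C * second_diff_energy p \<gamma> f"
      by (intro mult_right_mono ennreal_leI) simp_all
    finally show "ennreal (1 / ?C) * second_diff_energy p \<gamma> f \<le> simplex_energy p \<beta> (DIM('a) + 1) f
        \<and> simplex_energy p \<beta> (DIM('a) + 1) f \<le> ennreal ?C * second_diff_energy p \<gamma> f"
      using lower by simp
  qed
qed

subsection \<open>Passage to Lebesgue measurable functions\<close>

lemma sigma_finite_measure_completion:
  assumes "sigma_finite_measure M"
  shows "sigma_finite_measure (completion M)"
proof (rule sigma_finite_measure.intro)
  obtain A where A: "countable A" "A \<subseteq> sets M" "\<Union>A = space M" "\<And>a. a \<in> A \<Longrightarrow> emeasure M a \<noteq> \<infinity>"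
    using sigma_finite_measure.sigma_finite_countable[OF assms] by metis
  have "\<Union>A = space (completion M)" "A \<subseteq> sets (completion M)" "\<forall>a\<in>A. emeasure (completion M) a \<noteq> \<infinity>"
    using A by (auto simp: subset_eq)
  thus "\<exists>A. countable A \<and> A \<subseteq> sets (completion M) \<and> \<Union>A = space (completion M)
      \<and> (\<forall>a\<in>A. emeasure (completion M) a \<noteq> \<infinity>)"
    using A(1) by blast
qed

lemma (in product_sigma_finite) product_sigma_finite_completion:
  "product_sigma_finite (\<lambda>i. completion (M i))"
  by (intro product_sigma_finite.intro sigma_finite_measure_completion sigma_finite_measures)

lemma measurable_ident_PiM_completion:
  "(\<lambda>X. X) \<in> PiM I (\<lambda>i. completion (M i)) \<rightarrow>\<^sub>M PiM I M"
proof (rule measurable_PiM_single')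
  fix i assume "i \<in> I"
  hence "(\<lambda>X. X i) \<in> PiM I (\<lambda>i. completion (M i)) \<rightarrow>\<^sub>M completion (M i)"
    by (rule measurable_component_singleton)
  moreover have "(\<lambda>x. x) \<in> completion (M i) \<rightarrow>\<^sub>M M i"
    by (rule measurable_completion) simp
  ultimately show "(\<lambda>X. X i) \<in> PiM I (\<lambda>i. completion (M i)) \<rightarrow>\<^sub>M M i"
    by (rule measurable_compose)
qed (auto simp: space_PiM)

lemma (in product_sigma_finite) distr_PiM_completion:
  assumes I: "finite I"
  shows "distr (PiM I (\<lambda>i. completion (M i))) (PiM I M) (\<lambda>X. X) = PiM I M"
proof (rule PiM_eqI[OF I])
  interpret C: product_sigma_finite "\<lambda>i. completion (M i)" by (rule product_sigma_finite_completion)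
  fix A assume A: "\<And>i. i \<in> I \<Longrightarrow> A i \<in> sets (M i)"
  have "(\<lambda>X. X) -` Pi\<^sub>E I A \<inter> space (PiM I (\<lambda>i. completion (M i))) = Pi\<^sub>E I A"
    using A sets.sets_into_space by (fastforce simp: space_PiM PiE_iff)
  hence "emeasure (distr (PiM I (\<lambda>i. completion (M i))) (PiM I M) (\<lambda>X. X)) (Pi\<^sub>E I A)
      = emeasure (PiM I (\<lambda>i. completion (M i))) (Pi\<^sub>E I A)"
    using A I by (subst emeasure_distr[OF measurable_ident_PiM_completion]) (auto intro: sets_PiM_I_finite)
  also have "\<dots> = (\<Prod>i\<in>I. emeasure (M i) (A i))"
    using A I by (subst C.emeasure_PiM) auto
  finally show "emeasure (distr (PiM I (\<lambda>i. completion (M i))) (PiM I M) (\<lambda>X. X)) (Pi\<^sub>E I A)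
      = (\<Prod>i\<in>I. emeasure (M i) (A i))" .
qed simp

lemma (in product_sigma_finite) nn_integral_PiM_completion:
  assumes "finite I" "G \<in> borel_measurable (PiM I M)"
  shows "(\<integral>\<^sup>+X. G X \<partial>PiM I (\<lambda>i. completion (M i))) = (\<integral>\<^sup>+X. G X \<partial>PiM I M)"
  using nn_integral_distr[OF measurable_ident_PiM_completion, of G I M] assms
  by (simp add: distr_PiM_completion)

lemma (in product_sigma_finite) AE_PiM_component:
  assumes I: "finite I" "i \<in> I" and P: "AE x in M i. P x"
  shows "AE X in PiM I M. P (X i)"
proof -
  obtain N where N: "{x \<in> space (M i). \<not> P x} \<subseteq> N" "emeasure (M i) N = 0" "N \<in> sets (M i)"
    using P by (auto elim: AE_E)
  let ?A = "\<lambda>j. if j = i then N else space (M j)"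
  have "emeasure (PiM I M) (Pi\<^sub>E I ?A) = (\<Prod>j\<in>I. emeasure (M j) (?A j))"
    using I N by (intro emeasure_PiM) auto
  also have "\<dots> = 0"
    using I N by (intro prod_zero) (auto intro!: bexI[of _ i])
  finally have "Pi\<^sub>E I ?A \<in> null_sets (PiM I M)"
    using I N by (intro null_setsI sets_PiM_I_finite) auto
  moreover have "{X \<in> space (PiM I M). \<not> P (X i)} \<subseteq> Pi\<^sub>E I ?A"
    using I N by (auto simp: space_PiM PiE_iff extensional_def)
  ultimately show ?thesis
    by (rule AE_I')
qed

lemma diam_pts_eq_diameter: "diam_pts m X = diameter (X ` {..m})"
proof -
  have "{dist (X i) (X j) | i j. i \<le> m \<and> j \<le> m} = case_prod dist ` (X ` {..m} \<times> X ` {..m})"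
    by force
  thus ?thesis
    by (simp add: diam_pts_def diameter_finite)
qed

lemma energy_eq_nn_integral_simplex_density:
  "energy p q (f :: 'a::euclidean_space \<Rightarrow> real)
    = (\<integral>\<^sup>+X. simplex_density p (real (DIM('a) + 2) * q) f (X ` {..DIM('a) + 1})
      \<partial>PiM {..DIM('a) + 1} (\<lambda>_. lebesgue))"
proof -
  have "{graph_pt f (X i) | i. i \<le> m} = graph_pt f ` X ` {..m}" for X and m :: nat
    by auto
  thus ?thesis
    by (simp only: energy_def simplex_density_def graph_hull_volume_def diam_pts_eq_diameter)
qed

lemma simplex_density_cong:
  assumes "\<And>x. x \<in> A \<Longrightarrow> f x = g x"
  shows "simplex_density p \<beta> f A = simplex_density p \<beta> g A"
  using assms by (simp add: simplex_density_def graph_hull_volume_def graph_pt_def cong: image_cong)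

lemma energy_eq_simplex_energy:
  fixes f g :: "'a::euclidean_space \<Rightarrow> real"
  assumes g: "g \<in> borel_measurable borel" and fg: "AE x in lborel. f x = g x"
  shows "energy p q f = simplex_energy p (real (DIM('a) + 2) * q) (DIM('a) + 1) g"
proof -
  let ?m = "DIM('a) + 1" and ?dens = "simplex_density p (real (DIM('a) + 2) * q)"
  interpret B: product_sigma_finite "\<lambda>_. lborel :: 'a measure" by (rule product_sigma_finite_lborel)
  interpret L: product_sigma_finite "\<lambda>_. lebesgue :: 'a measure" by (rule B.product_sigma_finite_completion)
  have "AE X in PiM {..?m} (\<lambda>_. lebesgue). f (X i) = g (X i)" if "i \<in> {..?m}" for i
    using that AE_completion[OF fg] by (intro L.AE_PiM_component) simp_all
  hence "AE X in PiM {..?m} (\<lambda>_. lebesgue). \<forall>i\<in>{..?m}. f (X i) = g (X i)"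
    by (intro AE_finite_allI) simp_all
  hence "energy p q f = (\<integral>\<^sup>+X. ?dens g (X ` {..?m}) \<partial>PiM {..?m} (\<lambda>_. lebesgue))"
    unfolding energy_eq_nn_integral_simplex_density
    by (intro nn_integral_cong_AE) (auto elim!: eventually_mono intro!: simplex_density_cong)
  also have "\<dots> = (\<integral>\<^sup>+X. ?dens g (X ` {..?m}) \<partial>PiM {..?m} (\<lambda>_. lborel))"
    by (intro B.nn_integral_PiM_completion borel_measurable_simplex_density g measurable_component_lborel)
      simp_all
  finally show ?thesis
    by (simp only: simplex_energy_def)
qed

lemma sobolev_seminorm_pow_eq_second_diff_energy:
  fixes f g :: "'a::euclidean_space \<Rightarrow> real"
  assumes fg: "AE x in lborel. f x = g x"
  shows "sobolev_seminorm_pow s p f = second_diff_energy p (real DIM('a) + (1 + s) * p) g"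
  unfolding sobolev_seminorm_pow_def second_diff_energy_def nn_integral_completion
proof (rule nn_integral_cong_AE, use fg in eventually_elim, rule nn_integral_cong_AE)
  fix x assume x: "f x = g x"
  show "AE h in lborel. ennreal (\<bar>f (x + h) - 2 * f x + f (x - h)\<bar> powr p
      / norm h powr (real DIM('a) + (1 + s) * p))
    = ennreal (\<bar>second_diff g h x\<bar> powr p / norm h powr (real DIM('a) + (1 + s) * p))"
    using AE_lborel_translate[OF fg, of x] AE_lborel_reflect[OF fg, of x]
    by eventually_elim (simp add: second_diff_def x)
qed

lemma energy_sobolev_comparable:
  fixes s p q :: real
  assumes p: "1 \<le> p" and s: "0 \<le> s"
    and q: "real (DIM('a::euclidean_space) + 2) * q
      = real (DIM('a) * (DIM('a) + 1)) + p * (real DIM('a) + 1 + s)"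
  obtains C where "0 < C" "\<And>f :: 'a \<Rightarrow> real. f \<in> borel_measurable lebesgue \<Longrightarrow>
      ennreal (1 / C) * sobolev_seminorm_pow s p f \<le> energy p q f
      \<and> energy p q f \<le> ennreal C * sobolev_seminorm_pow s p f"
proof -
  let ?\<gamma> = "real DIM('a) + (1 + s) * p" and ?m = "DIM('a) + 1"
  have exponent: "energy_exponent DIM('a) ?m p ?\<gamma> = real (DIM('a) + 2) * q"
    unfolding q by (simp add: energy_exponent_def algebra_simps)
  have "0 < ?\<gamma>"
    using p s by (simp add: add_pos_nonneg)
  from simplex_energy_comparable[OF p this, where 'a='a, unfolded exponent]
  obtain C where C: "0 < C" "\<And>g :: 'a \<Rightarrow> real. g \<in> borel_measurable borel \<Longrightarrow>
      ennreal (1 / C) * second_diff_energy p ?\<gamma> g \<le> simplex_energy p (real (DIM('a) + 2) * q) ?m g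
      \<and> simplex_energy p (real (DIM('a) + 2) * q) ?m g \<le> ennreal C * second_diff_energy p ?\<gamma> g"
    by metis
  show thesis
  proof (rule that[OF C(1)])
    fix f :: "'a \<Rightarrow> real" assume "f \<in> borel_measurable lebesgue"
    then obtain g where g: "g \<in> borel_measurable borel" "AE x in lborel. f x = g x"
      using completion_ex_borel_measurable_real[of f lborel] by auto
    show "ennreal (1 / C) * sobolev_seminorm_pow s p f \<le> energy p q f
        \<and> energy p q f \<le> ennreal C * sobolev_seminorm_pow s p f"
      using C(2)[OF g(1)]
      unfolding energy_eq_simplex_energy[OF g] sobolev_seminorm_pow_eq_second_diff_energy[OF g(2)] .
  qed
qed

lemma ennreal_less_top_iff_comparable:
  fixes x y :: ennreal
  assumes "0 < C" "ennreal (1 / C) * x \<le> y" "y \<le> ennreal C * x"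
  shows "y < \<infinity> \<longleftrightarrow> x < \<infinity>"
proof
  assume "y < \<infinity>"
  hence "ennreal (1 / C) * x < \<infinity>"
    using assms(2) by (rule le_less_trans[rotated])
  thus "x < \<infinity>"
    using \<open>0 < C\<close> by (auto simp: ennreal_mult_less_top)
next
  assume "x < \<infinity>"
  hence "ennreal C * x < \<infinity>"
    by (simp add: ennreal_mult_less_top)
  thus "y < \<infinity>"
    using assms(3) by (rule le_less_trans[rotated])
qed

theorem theorem1p2:
  fixes s p q :: real
  assumes "0 < s" "s < 1" "1 < p" "real DIM('a::euclidean_space) / p < 1 + s"
    and "q = real (DIM('a) * (DIM('a) + 1)) / real (DIM('a) + 2)
             + p * (real DIM('a) + 1 + s) / real (DIM('a) + 2)"
  shows "(\<forall>f :: 'a \<Rightarrow> real. f \<in> borel_measurable lebesgue \<longrightarrow>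
            (energy p q f < \<infinity> \<longleftrightarrow> sobolev_seminorm_pow s p f < \<infinity>))
       \<and> (\<exists>C>0. \<forall>f :: 'a \<Rightarrow> real. f \<in> borel_measurable lebesgue \<longrightarrow>
            ennreal (1 / C) * sobolev_seminorm_pow s p f \<le> energy p q f
            \<and> energy p q f \<le> ennreal C * sobolev_seminorm_pow s p f)"
proof -
  have "real (DIM('a) + 2) * q = real (DIM('a) * (DIM('a) + 1)) + p * (real DIM('a) + 1 + s)"
    unfolding assms(5) distrib_left by simp
  then obtain C where C: "0 < C" "\<And>f :: 'a \<Rightarrow> real. f \<in> borel_measurable lebesgue \<Longrightarrow>
      ennreal (1 / C) * sobolev_seminorm_pow s p f \<le> energy p q f
      \<and> energy p q f \<le> ennreal C * sobolev_seminorm_pow s p f"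
    using energy_sobolev_comparable[of p s q] assms by auto
  hence "energy p q f < \<infinity> \<longleftrightarrow> sobolev_seminorm_pow s p f < \<infinity>"
    if "f \<in> borel_measurable lebesgue" for f :: "'a \<Rightarrow> real"
    using ennreal_less_top_iff_comparable that by blast
  with C show ?thesis by blast
qed

end
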